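(* For every integer $m\ge 3$ there exist real numbers $\alpha\in(0,1)$ and $C$, depending only on $m$, such that the following holds. Let $n$ be a positive integer with $m\le n+2$ and let $q$ be a power of a prime. Suppose that either $q$ is odd, or $m$ and $q$ are both even. Then $$ M_{m-1}(n,q) \;<\; 2m + m \cdot \min_{t \in (0,1)}\left(t^{-\frac{q-1}{m}} \cdot \frac{1-t^q}{1-t}\right)^n \;\le\; 2m + m \cdot\left(\frac{m\,e^{1-\frac{\alpha}{m}}}{m^2-\alpha m+\alpha}\,q + C \right)^n . $$
   Context: $AG(n,q)$ denotes the $n$-dimensional affine space over the finite field $\mathbb{F}_q$ (identified with $\mathbb{F}_q^n$). A $k$-flat is a $k$-dimensional affine subspace of $AG(n,q)$. For $3\le m\le n+2$, a set $A\subset AG(n,q)$ of size greater than $m$ is called $m$-general if no $m$ (distinct) points of $A$ lie on a single $(m-2)$-flat; equivalently, every $m$-point subset of $A$ is in general position. $M_{m-1}(n,q)$ denotes the maximum size of an $m$-general set in $AG(n,q)$ (read as $0$ if no such set exists). *)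

theory Defs
  imports Complex_Main "HOL-Number_Theory.Prime_Powers" "HOL-Algebra.AbelCoset"
    "Jordan_Normal_Form.Missing_VectorSpace"
begin

text \<open>
  The coefficient field is a record rather than a type, so that its order can be quantified inside a
  formula (constants may then depend on \<open>m\<close> only). Every finite field is isomorphic to one whose
  carrier is a set of naturals, so quantifying over fields of type \<^typ>\<open>nat ring\<close> covers all of
  them. Points are functions from \<open>{..<n}\<close> to the field, \<^const>\<open>undefined\<close> outside \<open>{..<n}\<close>.
\<close>

definition AG :: "'a ring \<Rightarrow> nat \<Rightarrow> ('a, nat \<Rightarrow> 'a) module" where
  "AG F n = ring.func_space F {..<n}"

definition is_flat :: "'a ring \<Rightarrow> nat \<Rightarrow> nat \<Rightarrow> (nat \<Rightarrow> 'a) set \<Rightarrow> bool" where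
  "is_flat F n k S \<longleftrightarrow>
     (\<exists>W p. subspace F W (AG F n) \<and> vectorspace.dim F ((AG F n)\<lparr>carrier := W\<rparr>) = k \<and>
            p \<in> carrier (AG F n) \<and> S = p <+\<^bsub>AG F n\<^esub> W)"

text \<open>The truncated subtraction \<open>m - 2\<close> is only meaningful for \<open>3 \<le> m \<le> n + 2\<close>.\<close>

definition m_general :: "nat \<Rightarrow> 'a ring \<Rightarrow> nat \<Rightarrow> (nat \<Rightarrow> 'a) set \<Rightarrow> bool" where
  "m_general m F n A \<longleftrightarrow>
     A \<subseteq> carrier (AG F n) \<and> card A > m \<and>
     \<not> (\<exists>B S. B \<subseteq> A \<and> card B = m \<and> is_flat F n (m - 2) S \<and> B \<subseteq> S)"

text \<open>
  \<open>max_general m F n\<close> is \<open>M\<^sub>m\<^sub>-\<^sub>1(n,q)\<close> for a field \<open>F\<close> of order \<open>q\<close>: note the index shift. For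
  finite \<open>F\<close> the space has finitely many subsets, so \<^const>\<open>Max\<close> is a genuine maximum; the inserted
  \<open>0\<close> is the value when there is no \<open>m\<close>-general set.
\<close>

definition max_general :: "nat \<Rightarrow> 'a ring \<Rightarrow> nat \<Rightarrow> nat" where
  "max_general m F n = Max (insert 0 (card ` {A. m_general m F n A}))"

definition min_target :: "nat \<Rightarrow> nat \<Rightarrow> nat \<Rightarrow> real \<Rightarrow> real" where
  "min_target m n q t =
     (t powr (- ((real q - 1) / real m)) * ((1 - t ^ q) / (1 - t))) ^ n"

end

theory Submission
  imports Defs "HOL-Algebra.Multiplicative_Group"
begin

text \<open>
  Write \<open>f(t) = t\<^sup>-\<^sup>(\<^sup>q\<^sup>-\<^sup>1\<^sup>)\<^sup>/\<^sup>m (1 + t + \<dots> + t\<^sup>q\<^sup>-\<^sup>1)\<close>, so that the quantity to be minimised is \<open>f(t)\<^sup>n\<close>.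
  Every \<open>m\<close>-general set \<open>A\<close> satisfies \<open>card A \<le> m f(t)\<^sup>n\<close> for every \<open>t\<close> in \<open>(0,1)\<close>, which is
  stronger than the first inequality. The reason depends on \<open>m\<close>.

  For \<open>m \<ge> 4\<close> it is a count of subset sums. Put \<open>k = m div 2\<close>. Two different \<open>k\<close>-subsets of \<open>A\<close>
  with the same sum differ in at most \<open>2k \<le> m\<close> points, and these would be affinely dependent; an
  affine dependence among at most \<open>m\<close> points of \<open>A\<close> puts \<open>m\<close> of its points on an \<open>(m-2)\<close>-flat
  (\<open>m_general_affinely_independent\<close>). So the binomial coefficient of \<open>card A\<close> over \<open>k\<close> is at most
  \<open>q\<^sup>n\<close> (\<open>choose_half_le\<close>), hence \<open>card A \<le> k q\<^sup>n\<^sup>/\<^sup>k\<close>. It remains to see that \<open>q \<le> f(t)\<^sup>k\<close>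
  (\<open>target_root_power_ge\<close>). For even \<open>m\<close> this is the inequality of arithmetic and geometric means,
  \<open>1 + \<dots> + t\<^sup>q\<^sup>-\<^sup>1 \<ge> q t\<^sup>(\<^sup>q\<^sup>-\<^sup>1\<^sup>)\<^sup>/\<^sup>2\<close>. For odd \<open>m\<close> the exponent \<open>1/k\<close> exceeds \<open>2/m\<close>, and one applies the
  same inequality to a shorter initial segment of the sum instead, which suffices for \<open>q \<ge> 3\<close>.

  For \<open>m = 3\<close> the sets are caps, \<open>k = 1\<close> gives only \<open>q\<^sup>n\<close>, and the slice rank argument of Croot,
  Lev, Pach, Ellenberg, Gijswijt and Tao takes over. As \<open>q\<close> is odd, \<open>2 \<noteq> 0\<close>, and \<open>x + y = 2z\<close> on a
  cap forces \<open>x = y = z\<close> (\<open>cap_three_term_eq\<close>). Hence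
  the product over the coordinates of \<open>1 - (x\<^sub>i + y\<^sub>i - 2z\<^sub>i)\<^sup>q\<^sup>-\<^sup>1\<close> is a diagonal tensor on \<open>A\<close>. Each of
  its monomials has total degree at most \<open>n(q-1)\<close>, hence degree at most \<open>n(q-1)/3\<close> in one of the
  three points, so it is a sum of \<open>3 M\<close> slices, where \<open>M\<close> is the number of such exponent vectors.
  A diagonal tensor on \<open>A\<close> needs \<open>card A\<close> slices (\<open>slice_rank_diagonal\<close>), and \<open>M \<le> f(t)\<^sup>n\<close> because
  every exponent vector counted by \<open>M\<close> contributes at least \<open>1\<close> to the expansion of \<open>f(t)\<^sup>n\<close>
  (\<open>card_low_exps_le\<close>).

  The minimum is attained because \<open>f\<close> tends to infinity at \<open>0\<close>, while \<open>f(1) = q\<close> and \<open>f'(1) > 0\<close>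
  (\<open>target_root_argmin\<close>). For the second inequality take \<open>\<alpha> = e\<^sup>-\<^sup>m\<close> and \<open>C = e\<close> and compare the
  minimum with the value of \<open>f\<close> at \<open>t = e\<^sup>-\<^sup>u\<^sup>/\<^sup>q\<close> for \<open>u = m - \<alpha>\<close> (\<open>target_root_upper\<close>).
\<close>

section \<open>The one-variable function behind the bound\<close>

text \<open>
  The function \<open>f\<close> above. The geometric sum replaces the quotient \<open>(1 - t\<^sup>q) / (1 - t)\<close>, so that \<open>t = 1\<close>
  is a regular point; the search for the minimum uses the value and the derivative there.
\<close>

definition target_root :: "nat \<Rightarrow> nat \<Rightarrow> real \<Rightarrow> real" where
  "target_root m q t = t powr (- ((real q - 1) / real m)) * (\<Sum>j<q. t ^ j)"

lemma min_target_eq: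
  assumes "t \<noteq> 1"
  shows "min_target m n q t = target_root m q t ^ n"
  using assms by (simp add: min_target_def target_root_def sum_gp_strict)

lemma target_root_pos: "0 < t \<Longrightarrow> 0 < q \<Longrightarrow> 0 < target_root m q t"
  unfolding target_root_def by (intro mult_pos_pos sum_pos) (auto simp: lessThan_empty_iff)

text \<open>
  Arithmetic-geometric mean, pairing the \<open>j\<close>-th term with the \<open>j\<close>-th term from the end. The squared
  variable keeps the exponent \<open>(r-1)/2\<close> of the geometric mean integral.
\<close>

lemma geometric_ge_middle:
  fixes s :: real
  assumes "0 \<le> s"
  shows "real r * s ^ (r - 1) \<le> (\<Sum>j<r. (s\<^sup>2) ^ j)"
proof -
  have "2 * (real r * s ^ (r - 1)) = (\<Sum>j<r. 2 * (s ^ j * s ^ (r - Suc j)))"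
    by (simp flip: power_add add: Suc_diff_Suc)
  also have "\<dots> \<le> (\<Sum>j<r. (s\<^sup>2) ^ j + (s\<^sup>2) ^ (r - Suc j))"
  proof (rule sum_mono)
    fix j
    have "0 \<le> (s ^ j - s ^ (r - Suc j))\<^sup>2" by simp
    then show "2 * (s ^ j * s ^ (r - Suc j)) \<le> (s\<^sup>2) ^ j + (s\<^sup>2) ^ (r - Suc j)"
      by (simp add: power2_diff power_mult[symmetric] mult.commute mult.left_commute)
  qed
  also have "\<dots> = 2 * (\<Sum>j<r. (s\<^sup>2) ^ j)"
    using sum.nat_diff_reindex[of "\<lambda>j. (s\<^sup>2) ^ j" r] by (simp add: sum.distrib)
  finally show ?thesis by simp
qed

lemma geometric_sum_mono:
  fixes t :: real
  assumes "0 \<le> t" "r \<le> q"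
  shows "(\<Sum>j<r. t ^ j) \<le> (\<Sum>j<q. t ^ j)"
  using assms by (intro sum_mono2) auto

lemma linear_le_power:
  fixes r k :: nat
  assumes "2 \<le> k" "3 \<le> r"
  shows "(2 * k + 1) * r + 1 \<le> 2 * r ^ k"
  using assms(1)
proof (induction k rule: dec_induct)
  case base
  have "5 * r + 1 \<le> 2 * (r * r)"
    using mult_le_mono1[OF assms(2), of r] assms(2) by linarith
  then show ?case by (simp add: power2_eq_square)
next
  case (step k)
  have "(2 * Suc k + 1) * r + 1 \<le> 3 * ((2 * k + 1) * r + 1)"
    by (simp add: algebra_simps)
  also have "\<dots> \<le> r * (2 * r ^ k)"
    using assms(2) step.IH by (rule mult_le_mono)
  finally show ?case by simp
qed

lemma four_mul_le_power:
  fixes k :: nat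
  assumes "3 \<le> k"
  shows "4 * k + 3 \<le> 2 * 2 ^ k"
  using assms by (induction k rule: dec_induct) auto

text \<open>
  The arithmetic behind the use of \<open>1 + t \<ge> 2 t\<^sup>1\<^sup>/\<^sup>2\<close> when \<open>q\<close> is small compared with \<open>m = 2k + 1\<close>.
\<close>

lemma odd_small_arith:
  fixes k q :: nat
  assumes "2 \<le> k" "3 \<le> q" "2 * (q - 1) \<le> 2 * k + 1"
  shows "q ^ (2 * k + 1) \<le> 2 ^ (2 * (q - 1) * k)"
proof (cases "q = 3")
  case True
  have "3 * 9 ^ k \<le> (16::nat) ^ k"
    using assms(1) by (induction k rule: dec_induct) auto
  then show ?thesis
    by (simp add: True power_mult)
next
  case False
  have q: "2 * q \<le> 2 ^ (q - 1)"
  proof -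
    have "4 \<le> q" using False assms by simp
    then show ?thesis
    proof (induction q rule: dec_induct)
      case (step n)
      then obtain l where "n = Suc l" by (cases n) auto
      with step show ?case by simp
    qed simp
  qed
  have "q \<le> k + 1" using assms by linarith
  also have "k + 1 \<le> 2 ^ k" by (induction k) auto
  also have "\<dots> \<le> 2 ^ (2 * k)" by (rule power_increasing) auto
  finally have "q ^ (2 * k + 1) \<le> 2 ^ (2 * k) * q ^ (2 * k)" by simp
  also have "\<dots> = (2 * q) ^ (2 * k)" by (simp add: power_mult_distrib)
  also have "\<dots> \<le> (2 ^ (q - 1)) ^ (2 * k)" using q by (rule power_mono) simp
  finally show ?thesis by (simp add: power_mult[symmetric] ac_simps)
qed

text \<open>
  The inequality \<open>q \<le> f(t)\<^sup>k\<close> with \<open>t = s\<^sup>2\<close>, raised to the power \<open>m\<close> so that all exponents are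
  integers. Every \<open>r \<le> q\<close> gives \<open>S \<ge> r s\<^sup>r\<^sup>-\<^sup>1\<close>. The best choice has \<open>(r-1) m\<close> close to, but not above,
  \<open>2(q-1)\<close>: then the power of \<open>s\<close> is small enough and \<open>r\<^sup>k \<ge> q\<close>. If already \<open>r = 2\<close> is too large, a
  smaller power of \<open>S \<ge> 2 s\<close> is used, which is legitimate because \<open>S \<ge> 1\<close>.
\<close>

lemma geometric_sum_power_ge:
  fixes s :: real
  assumes s: "0 < s" "s < 1" and m: "4 \<le> m" and q: "2 \<le> q" and odd: "odd m \<Longrightarrow> 3 \<le> q"
  defines "k \<equiv> m div 2" and "S \<equiv> (\<Sum>j<q. (s\<^sup>2) ^ j)"
  shows "real q ^ m * s ^ (2 * k * (q - 1)) \<le> S ^ (k * m)"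
proof -
  have ge: "real r * s ^ (r - 1) \<le> S" if "r \<le> q" for r
    using geometric_ge_middle[of s r] geometric_sum_mono[of "s\<^sup>2" r q] s that
    unfolding S_def by simp
  have S1: "1 \<le> S" using ge[of 1] q by simp
  have k: "2 \<le> k" using m by (simp add: k_def)
  show ?thesis
  proof (cases "even m")
    case True
    then have mk: "m = 2 * k" by (auto simp: k_def)
    have "real q ^ m * s ^ (2 * k * (q - 1)) = (real q * s ^ (q - 1)) ^ m"
      by (simp add: mk power_mult_distrib power_mult[symmetric] mult.commute)
    also have "\<dots> \<le> S ^ m" using ge[of q] s by (intro power_mono) auto
    also have "\<dots> \<le> S ^ (k * m)" using S1 k by (intro power_increasing) auto
    finally show ?thesis .
  next
    case False
    then have mk: "m = 2 * k + 1" and q3: "3 \<le> q" using odd by (auto simp: k_def)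
    show ?thesis
    proof (cases "2 * (q - 1) \<le> m")
      case small: True
      have "real (q ^ m) \<le> real (2 ^ (2 * (q - 1) * k))"
        using odd_small_arith[OF k q3] small unfolding mk of_nat_le_iff by simp
      then have "real q ^ m * s ^ (2 * k * (q - 1)) \<le> 2 ^ (2 * (q - 1) * k) * s ^ (2 * k * (q - 1))"
        using s by (intro mult_right_mono) auto
      also have "\<dots> = (2 * s) ^ (2 * (q - 1) * k)"
        by (simp add: power_mult_distrib ac_simps)
      also have "\<dots> \<le> S ^ (2 * (q - 1) * k)"
        using ge[of 2] s q by (intro power_mono) auto
      also have "\<dots> \<le> S ^ (k * m)"
        using S1 small mult_le_mono1[OF small, of k] by (intro power_increasing) (auto simp: mult.commute)
      finally show ?thesis .
    next
      case large: False
      define d where "d = 2 * (q - 1) div m"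
      define r where "r = Suc d"
      have d1: "d * m \<le> 2 * (q - 1)" by (simp add: d_def)
      have d2: "2 * (q - 1) < r * m"
        using dividend_less_div_times[of m "2 * (q - 1)"] m by (simp add: r_def d_def)
      have r2: "2 \<le> r"
      proof -
        have "d \<noteq> 0" using large m by (auto simp: d_def div_eq_0_iff)
        then show ?thesis by (simp add: r_def)
      qed
      have dq: "r \<le> q"
      proof -
        have "d * 2 \<le> d * m" using m by (intro mult_le_mono) auto
        then show ?thesis using d1 q unfolding r_def by linarith
      qed
      have bound: "2 * q \<le> (2 * k + 1) * r + 1"
        using d2 q by (simp add: mk mult.commute)
      have main: ?thesis if "q \<le> r ^ k"
      proof -
        have "real q \<le> real r ^ k" using that by (metis of_nat_le_iff of_nat_power)
        moreover have e: "d * m * k \<le> 2 * k * (q - 1)"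
          using mult_le_mono1[OF d1, of k] by (simp only: ac_simps)
        ultimately have "real q ^ m * s ^ (2 * k * (q - 1)) \<le> (real r ^ k) ^ m * s ^ (d * m * k)"
          using s by (intro mult_mono power_mono power_decreasing[OF e] zero_le_power) simp_all
        also have "\<dots> = (real r * s ^ (r - 1)) ^ (k * m)"
          by (simp add: r_def power_mult_distrib power_mult[symmetric] ac_simps)
        also have "\<dots> \<le> S ^ (k * m)"
          using ge[OF dq] s by (intro power_mono) auto
        finally show ?thesis .
      qed
      consider "3 \<le> r" | "r = 2" "3 \<le> k" | "r = 2" "k = 2" using r2 k by linarith
      then show ?thesis
      proof cases
        case 1
        then show ?thesis using main linear_le_power[OF k 1] bound by linarith
      next
        case 2
        then show ?thesis using main four_mul_le_power[OF 2(2)] bound by auto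
      next
        case 3
        then have m5: "m = 5" and q45: "q = 4 \<or> q = 5" using mk bound large by auto
        show ?thesis
        proof (cases "q = 4")
          case True
          then show ?thesis using main 3 by simp
        next
          case False
          then have q5: "q = 5" using q45 by simp
          \<comment> \<open>For \<open>m = q = 5\<close>, \<open>r = 2\<close> alone gives too small a factor and \<open>r = 3\<close> alone too high a power of \<open>s\<close>;
            \<open>S ^ 4\<close> bounded by the former and \<open>S ^ 6\<close> by the latter balance out, and \<open>2 ^ 4 * 3 ^ 6 = 11664\<close>.\<close>
          have "real q ^ m * s ^ (2 * k * (q - 1)) \<le> 11664 * s ^ 16"
            using s by (simp add: q5 m5 3)
          also have "\<dots> = (2 * s) ^ 4 * (3 * s\<^sup>2) ^ 6"
            by (simp add: power_mult_distrib flip: power_mult power_add)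
          also have "\<dots> \<le> S ^ 4 * S ^ 6"
            using ge[of 2] ge[of 3] s q5 S1 by (intro mult_mono power_mono) auto
          also have "\<dots> = S ^ (k * m)" by (simp add: m5 3 flip: power_add)
          finally show ?thesis .
        qed
      qed
    qed
  qed
qed

lemma target_root_power_ge:
  assumes t: "0 < t" "t < 1" and m: "4 \<le> m" and q: "2 \<le> q" and odd: "odd m \<Longrightarrow> 3 \<le> q"
  shows "real q \<le> target_root m q t ^ (m div 2)"
proof -
  define s where "s = sqrt t"
  define k where "k = m div 2"
  have s: "0 < s" "s < 1" "s\<^sup>2 = t" using t by (auto simp: s_def)
  define x where "x = t powr (- ((real q - 1) / real m))"
  define S where "S = (\<Sum>j<q. t ^ j)"
  have x0: "0 < x" using t by (simp add: x_def)
  have "x ^ m = t powr (- (real q - 1))"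
    using t m by (simp add: x_def powr_power)
  also have "\<dots> = inverse (t ^ (q - 1))"
    using t q by (simp only: powr_minus powr_realpow[symmetric] of_nat_diff) (simp add: of_nat_diff)
  finally have xm: "x ^ m * t ^ (q - 1) = 1" using t by simp
  have "real q ^ m = (x ^ m * t ^ (q - 1)) ^ k * real q ^ m" by (simp only: xm) simp
  also have "\<dots> = x ^ (m * k) * (real q ^ m * s ^ (2 * k * (q - 1)))"
    by (simp add: power_mult_distrib s(3)[symmetric] power_mult[symmetric] ac_simps)
  also have "\<dots> \<le> x ^ (m * k) * S ^ (k * m)"
    using geometric_sum_power_ge[OF s(1,2) m q odd] x0
    unfolding S_def k_def s(3) by (intro mult_left_mono) auto
  also have "\<dots> = ((x * S) ^ k) ^ m"
    by (simp add: power_mult_distrib power_mult[symmetric] ac_simps)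
  finally have "real q ^ m \<le> (target_root m q t ^ k) ^ m"
    by (simp add: target_root_def x_def S_def)
  then show ?thesis
    using target_root_pos[OF t(1), of q m] q m by (simp add: power_mono_iff k_def)
qed

text \<open>
  Converts a bound on a binomial coefficient into a bound on \<open>N\<close>, by \<open>(N/k)\<^sup>k \<le> N choose k\<close>.
\<close>

lemma le_of_choose_le:
  assumes k: "0 < k" and q: "0 < q" and ch: "N choose k \<le> q ^ n" and x: "0 \<le> x" "real q \<le> x ^ k"
  shows "real N \<le> real k * x ^ n"
proof (cases "k \<le> N")
  case True
  have "(real N / real k) ^ k \<le> real (N choose k)"
    using binomial_ge_n_over_k_pow_k[OF True, where 'a = real] by simp
  also have "\<dots> \<le> real q ^ n" using ch by (metis of_nat_le_iff of_nat_power)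
  also have "\<dots> \<le> (x ^ k) ^ n" using x by (intro power_mono) auto
  also have "\<dots> = (x ^ n) ^ k" by (simp add: power_mult[symmetric] mult.commute)
  finally have "real N / real k \<le> x ^ n"
    using k x by (simp add: power_mono_iff)
  then show ?thesis using k by (simp add: field_simps)
next
  case False
  have "1 ^ k \<le> x ^ k" using q x(2) by simp
  then have "1 \<le> x" using k x(1) by (metis power_mono_iff zero_le_one)
  then have "real k * 1 \<le> real k * x ^ n" by (intro mult_left_mono one_le_power) auto
  moreover have "real N \<le> real k * 1" using False by simp
  ultimately show ?thesis by linarith
qed

lemma continuous_on_target_root: "0 < a \<Longrightarrow> continuous_on {a..1} (target_root m q)"
  unfolding target_root_def by (intro continuous_intros) auto

text \<open>
  On \<open>(0,1)\<close> compactness fails at both ends. Near \<open>0\<close> the factor \<open>t\<^sup>-\<^sup>b\<close> alone exceeds \<open>q = f(1)\<close>. At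
  \<open>1\<close> the logarithmic derivative is the mean \<open>(q-1)/2\<close> of the exponents in the sum minus \<open>b = (q-1)/m\<close>;
  it is positive as \<open>m > 2\<close>, so values smaller than \<open>f(1)\<close> occur to the left of \<open>1\<close>. A minimum over a
  compact \<open>[e,1]\<close> is therefore a minimum over \<open>(0,1)\<close>.
\<close>

lemma target_root_argmin:
  assumes m: "3 \<le> m" and q: "2 \<le> q"
  shows "\<exists>t\<in>{0<..<1}. \<forall>u\<in>{0<..<1}. target_root m q t \<le> target_root m q u"
proof -
  define b where "b = (real q - 1) / real m"
  have b0: "0 < b" using m q by (simp add: b_def)
  have "2 * (real q - 1) < real m * (real q - 1)" using m q by (intro mult_strict_right_mono) auto
  then have "2 * b < real q - 1" using m by (simp add: b_def field_simps)
  have at1: "target_root m q 1 = real q" by (simp add: target_root_def)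
  define D where "D = (\<Sum>j<q. real j) - b * real q"
  have "(target_root m q has_real_derivative D) (at 1)"
  proof -
    have *: "((\<lambda>t. \<Sum>j<q. t ^ j) has_real_derivative (\<Sum>j<q. real j)) (at (1::real))"
      by (auto intro!: derivative_eq_intros)
    have **: "((\<lambda>t. t powr (-b)) has_real_derivative (-b)) (at (1::real))"
      by (auto intro!: derivative_eq_intros)
    have "((\<lambda>t. t powr (-b) * (\<Sum>j<q. t ^ j)) has_real_derivative D) (at 1)"
      by (rule DERIV_cong[OF DERIV_mult[OF ** *]]) (simp add: D_def)
    then show ?thesis unfolding target_root_def b_def .
  qed
  moreover have "0 < D"
  proof -
    have "2 * (\<Sum>j<q. real j) = real q * (real q - 1)"
      using q by (induction q rule: dec_induct) (auto simp: algebra_simps numeral_2_eq_2)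
    then have "2 * D = real q * (real q - 1 - 2 * b)" by (simp add: D_def algebra_simps)
    also have "\<dots> > 0" using \<open>2 * b < real q - 1\<close> q by simp
    finally show ?thesis by simp
  qed
  ultimately obtain d where d: "0 < d" "\<And>h. 0 < h \<Longrightarrow> h < d \<Longrightarrow> target_root m q (1 - h) < target_root m q 1"
    using DERIV_pos_inc_left by blast
  define t0 where "t0 = 1 - min (d / 2) (1 / 2)"
  have t0: "0 < t0" "t0 < 1" "target_root m q t0 < real q"
    using d(2)[of "min (d / 2) (1 / 2)"] d(1) at1 by (auto simp: t0_def)
  define e where "e = min t0 (real q powr (- (1 / b)))"
  have e0: "0 < e" using t0 q by (simp add: e_def)
  have "\<exists>t\<in>{e..1}. \<forall>u\<in>{e..1}. target_root m q t \<le> target_root m q u"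
    using t0 e0 by (intro continuous_attains_inf continuous_on_target_root) (auto simp: e_def)
  then obtain t where t: "e \<le> t" "t \<le> 1" "\<And>u. e \<le> u \<Longrightarrow> u \<le> 1 \<Longrightarrow> target_root m q t \<le> target_root m q u"
    by auto
  have tq: "target_root m q t < real q"
    using t(3)[of t0] t0 by (auto simp: e_def)
  then have "t \<noteq> 1" using at1 by auto
  moreover have "target_root m q t \<le> target_root m q u" if u: "0 < u" "u < 1" for u
  proof (cases "e \<le> u")
    case False
    then have "u < real q powr (- (1 / b))" by (simp add: e_def t0)
    then have "(real q powr (- (1 / b))) powr (-b) \<le> u powr (-b)"
      using u b0 by (intro powr_mono2') auto
    then have "real q * 1 \<le> u powr (-b) * 1" using q b0 by (simp add: powr_powr)
    also have "\<dots> \<le> u powr (-b) * (\<Sum>j<q. u ^ j)"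
      using geometric_sum_mono[of u 1 q] u q by (intro mult_left_mono) auto
    finally show ?thesis using tq by (simp add: target_root_def b_def)
  qed (use t(3) u in simp)
  ultimately show ?thesis using t(1,2) e0 by (intro bexI[of _ t]) auto
qed

text \<open>
  With \<open>t = e\<^sup>-\<^sup>x\<close> and \<open>x = u/q\<close>, \<open>f(t)\<close> is at most \<open>e\<^sup>u\<^sup>/\<^sup>m (1 - e\<^sup>-\<^sup>u) (q/u + 1)\<close>, linear in \<open>q\<close>. The choice
  \<open>u = m - \<alpha>\<close> turns the first factor into \<open>e\<^sup>1\<^sup>-\<^sup>\<alpha>\<^sup>/\<^sup>m\<close>, and the coefficient of \<open>q\<close> is then the required one
  as soon as \<open>e\<^sup>-\<^sup>u\<close> is at least \<open>\<alpha> / (m\<^sup>2 - \<alpha> m + \<alpha>)\<close>. Equality there would mean that \<open>u\<close> minimises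
  \<open>e\<^sup>u\<^sup>/\<^sup>m (1 - e\<^sup>-\<^sup>u) / u\<close>; the explicit \<open>\<alpha> = e\<^sup>-\<^sup>m\<close> satisfies the inequality.
\<close>

lemma target_root_upper:
  fixes m q :: nat
  assumes m: "3 \<le> m" and q: "1 \<le> q"
  defines "\<alpha> \<equiv> exp (- real m)"
  shows "\<exists>t\<in>{0<..<1}. target_root m q t
    \<le> real m * exp (1 - \<alpha> / real m) / (real m ^ 2 - \<alpha> * real m + \<alpha>) * real q + exp 1"
proof -
  have a: "0 < \<alpha>" "\<alpha> < 1" using m by (auto simp: \<alpha>_def)
  define u where "u = real m - \<alpha>"
  have u: "0 < u" "u \<le> real m" using a m by (auto simp: u_def)
  define x where "x = u / real q"
  have x: "0 < x" using u q by (simp add: x_def)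
  define E where "E = exp (1 - \<alpha> / real m)"
  define c where "c = real m ^ 2 - \<alpha> * real m + \<alpha>"
  have c: "c = real m * u + \<alpha>" by (simp add: c_def u_def power2_eq_square algebra_simps)
  have c0: "1 \<le> c"
  proof -
    have "1 * 1 \<le> real m * u" using a m by (intro mult_mono) (auto simp: u_def)
    then show ?thesis using a c by simp
  qed
  have E: "exp (u / real m) = E" using m by (simp add: E_def u_def diff_divide_distrib)
  have "target_root m q (exp (- x)) = exp (x * ((real q - 1) / real m)) * ((1 - exp (- u)) / (1 - exp (- x)))"
  proof -
    have "exp (-x) \<noteq> 1" "exp (- x) ^ q = exp (- u)"
      using x q by (auto simp: x_def simp flip: exp_of_nat_mult)
    then show ?thesis
      by (simp add: target_root_def sum_gp_strict powr_def)
  qed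
  also have "\<dots> \<le> E * ((1 - \<alpha> / c) * (1 / x + 1))"
  proof (intro mult_mono)
    have "x * ((real q - 1) / real m) \<le> u / real m"
      using q m u x by (simp add: x_def field_simps)
    then show "exp (x * ((real q - 1) / real m)) \<le> E" unfolding E[symmetric] by simp
    have "\<alpha> / c \<le> \<alpha>" using a c0 by (simp add: field_simps)
    also have "\<alpha> \<le> exp (- u)" using a by (simp add: \<alpha>_def u_def)
    finally have 1: "1 - exp (- u) \<le> 1 - \<alpha> / c" by simp
    have 2: "1 / (1 - exp (- x)) \<le> 1 / x + 1"
    proof -
      have "exp (- x) * (1 + x) \<le> exp (- x) * exp x" by (intro mult_left_mono) auto
      also have "\<dots> = 1" by (simp flip: exp_add)
      finally have "exp (- x) * (1 + x) \<le> 1" .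
      then have "x \<le> (1 - exp (- x)) * (1 + x)" by (simp add: algebra_simps)
      then show ?thesis using x by (simp add: field_simps)
    qed
    have "(1 - exp (- u)) * (1 / (1 - exp (- x))) \<le> (1 - \<alpha> / c) * (1 / x + 1)"
      using 1 2 u x order_trans[OF _ 1, of 0] by (intro mult_mono) auto
    then show "(1 - exp (- u)) / (1 - exp (- x)) \<le> (1 - \<alpha> / c) * (1 / x + 1)" by simp
  qed (use u x in \<open>auto simp: E_def\<close>)
  also have "\<dots> = E * (1 - \<alpha> / c) * (1 / x) + E * (1 - \<alpha> / c)" by (simp add: algebra_simps)
  also have "E * (1 - \<alpha> / c) * (1 / x) = real m * E / c * real q"
  proof -
    have "1 - \<alpha> / c = real m * u / c" using c c0 by (simp add: field_simps)
    then have "E * (1 - \<alpha> / c) * (1 / x) = E * (real m * u / c) * (real q / u)" by (simp add: x_def)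
    also have "\<dots> = real m * E / c * real q" using u by simp
    finally show ?thesis .
  qed
  also have "E * (1 - \<alpha> / c) \<le> exp 1 * 1"
    using a c0 m by (intro mult_mono) (auto simp: E_def field_simps)
  finally show ?thesis using x by (intro bexI[of _ "exp (- x)"]) (auto simp: E_def c_def)
qed

definition low_exps :: "nat \<Rightarrow> nat \<Rightarrow> (nat \<Rightarrow> nat) set" where
  "low_exps n q = {u \<in> {..<n} \<rightarrow>\<^sub>E {..<q}. 3 * (\<Sum>i<n. u i) \<le> n * (q - 1)}"

lemma finite_low_exps: "finite (low_exps n q)"
  unfolding low_exps_def by (intro finite_subset[OF _ finite_PiE[of "{..<n}" "\<lambda>_. {..<q}"]]) auto

text \<open>
  A Chernoff-type estimate: the weight \<open>x\<^sup>n t\<^sup>|\<^sup>u\<^sup>|\<close> of an exponent vector \<open>u\<close> is at least \<open>1\<close> when its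
  degree is at most \<open>n(q-1)/3\<close>, and the total weight of all exponent vectors is \<open>f(t)\<^sup>n\<close>.
\<close>

lemma card_low_exps_le:
  assumes t: "0 < t" "t < 1" and q: "0 < q"
  shows "real (card (low_exps n q)) \<le> target_root 3 q t ^ n"
proof -
  define x where "x = t powr (- ((real q - 1) / 3))"
  have x: "0 < x" using t by (simp add: x_def)
  have "real (card (low_exps n q)) = (\<Sum>u\<in>low_exps n q. 1)" by simp
  also have "\<dots> \<le> (\<Sum>u\<in>low_exps n q. x ^ n * t ^ (\<Sum>i<n. u i))"
  proof (rule sum_mono)
    fix u assume u: "u \<in> low_exps n q"
    define d where "d = (\<Sum>i<n. u i)"
    have "3 * d \<le> n * (q - 1)" using u by (simp add: low_exps_def d_def)
    then have "real (3 * d) \<le> real (n * (q - 1))" by (simp only: of_nat_le_iff)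
    then have le: "real d - real n * ((real q - 1) / 3) \<le> 0"
      using q by (simp add: of_nat_diff algebra_simps)
    have "x ^ n * t ^ d = t powr (real d - real n * ((real q - 1) / 3))"
    proof -
      have "x ^ n = t powr (- (real n * ((real q - 1) / 3)))"
        using t by (simp add: x_def powr_power algebra_simps)
      moreover have "t ^ d = t powr real d" using t by (simp add: powr_realpow)
      ultimately show ?thesis by (simp add: powr_add[symmetric])
    qed
    also have "\<dots> \<ge> 1"
      using powr_mono'[OF le, of t] t by simp
    finally show "1 \<le> x ^ n * t ^ (\<Sum>i<n. u i)" by (simp add: d_def)
  qed
  also have "\<dots> \<le> (\<Sum>u\<in>{..<n} \<rightarrow>\<^sub>E {..<q}. x ^ n * t ^ (\<Sum>i<n. u i))"
    using x t by (intro sum_mono2 finite_PiE) (auto simp: low_exps_def)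
  also have "\<dots> = x ^ n * (\<Sum>u\<in>{..<n} \<rightarrow>\<^sub>E {..<q}. \<Prod>i<n. t ^ u i)"
    by (simp add: sum_distrib_left power_sum)
  also have "(\<Sum>u\<in>{..<n} \<rightarrow>\<^sub>E {..<q}. \<Prod>i<n. t ^ u i) = (\<Prod>i<n. \<Sum>j<q. t ^ j)"
    by (rule prod_sum_PiE[symmetric]) auto
  finally show ?thesis by (simp add: target_root_def x_def power_mult_distrib)
qed

section \<open>Affine dependence and flats\<close>

context vectorspace
begin

lemma card_span_le:
  assumes "finite (carrier K)" "finite U" "U \<subseteq> carrier V"
  shows "card (span U) \<le> card (carrier K) ^ card U"
proof -
  have "span U = (\<lambda>a. lincomb a U) ` (U \<rightarrow>\<^sub>E carrier K)"
  proof -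
    have "lincomb a U = lincomb (restrict a U) U" if "a \<in> U \<rightarrow> carrier K" for a
      using that assms(3) by (intro lincomb_cong) auto
    then show ?thesis
      unfolding finite_span[OF assms(2,3)] by (auto intro!: image_eqI[where x = "restrict _ U"])
  qed
  also have "card \<dots> \<le> card (U \<rightarrow>\<^sub>E carrier K)"
    using assms by (intro card_image_le finite_PiE) auto
  finally show ?thesis using assms by (simp add: card_PiE)
qed

lemma indep_extension:
  assumes "U \<subseteq> carrier V" "lin_indpt U" "v \<in> carrier V" "v \<notin> span U"
  shows "lin_indpt (insert v U)" "v \<notin> U"
proof -
  show "v \<notin> U" using assms in_own_span[OF assms(1)] by auto
  then show "lin_indpt (insert v U)" using lin_dep_iff_in_span[of U v] assms by auto
qed

text \<open>
  A flat must have dimension exactly \<open>d\<close>, so few vectors have to be covered by a span that is not too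
  small either. Vectors are adjoined one at a time; if the next one is already in the span, some other vector
  outside the span is adjoined, which exists because a span of fewer than \<open>n\<close> vectors has fewer than
  \<open>q\<^sup>n\<close> elements.
\<close>

lemma indep_set_spanning:
  assumes K: "finite (carrier K)" and V: "card (carrier V) = card (carrier K) ^ n"
    and D: "finite D" "D \<subseteq> carrier V" "card D \<le> d" and d: "d \<le> n"
  shows "\<exists>U. finite U \<and> U \<subseteq> carrier V \<and> lin_indpt U \<and> card U = d \<and> D \<subseteq> span U"
  using D d
proof (induction d arbitrary: D)
  case 0
  then show ?case by (intro exI[of _ "{}"]) (auto simp: lin_dep_def)
next
  case (Suc d)
  define v where "v = (if D = {} then \<zero>\<^bsub>V\<^esub> else SOME v. v \<in> D)"
  have v: "v \<in> carrier V" "D \<subseteq> insert v (D - {v})"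
    using Suc.prems(2) some_in_eq[of D] by (auto simp: v_def)
  have "card (D - {v}) \<le> d"
    using Suc.prems some_in_eq[of D] by (cases "D = {}") (auto simp: v_def card_Diff_singleton)
  then obtain U where U: "finite U" "U \<subseteq> carrier V" "lin_indpt U" "card U = d" "D - {v} \<subseteq> span U"
    using Suc.IH[of "D - {v}"] Suc.prems by auto
  have "\<exists>w\<in>carrier V. w \<notin> span U \<and> (v \<notin> span U \<longrightarrow> w = v)"
  proof (cases "v \<in> span U")
    case True
    have "{\<zero>\<^bsub>K\<^esub>, \<one>\<^bsub>K\<^esub>} \<subseteq> carrier K" by auto
    then have q: "2 \<le> card (carrier K)" using card_mono[OF K, of "{\<zero>\<^bsub>K\<^esub>, \<one>\<^bsub>K\<^esub>}"] by simp
    have "card (span U) \<le> card (carrier K) ^ d" using card_span_le[OF K U(1,2)] U(4) by simp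
    also have "\<dots> < card (carrier V)"
      unfolding V using q Suc.prems(4) by (intro power_strict_increasing) auto
    finally have "\<not> carrier V \<subseteq> span U"
      using span_is_subset2[OF U(2)] by auto
    then show ?thesis using True by auto
  qed (use v in auto)
  then obtain w where w: "w \<in> carrier V" "w \<notin> span U" "v \<notin> span U \<longrightarrow> w = v" by auto
  have "span U \<subseteq> span (insert w U)" by (intro span_is_monotone) auto
  moreover have "w \<in> span (insert w U)" using in_own_span[of "insert w U"] U w by auto
  ultimately have "D \<subseteq> span (insert w U)" using v(2) U(5) w(3) by auto
  then show ?case
    using U w indep_extension[OF U(2,3) w(1,2)] by (intro exI[of _ "insert w U"]) auto
qed

lemma dim_span_indep:
  assumes "finite U" "U \<subseteq> carrier V" "lin_indpt U"
  shows "vectorspace.dim K (vs (span U)) = card U"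
proof -
  have sub: "submodule K (span U) V" by (rule span_is_submodule[OF assms(2)])
  interpret W: vectorspace K "vs (span U)"
    by (rule subspace_is_vs[OF span_is_subspace[OF assms(2)]])
  have "U \<subseteq> span U" by (rule in_own_span[OF assms(2)])
  then show ?thesis
    using span_li_not_depend[OF _ sub, of U] assms by (intro W.dim_basis) (auto simp: W.basis_def)
qed

lemma subspace_of_dim_containing:
  assumes "finite (carrier K)" "card (carrier V) = card (carrier K) ^ n"
    and "finite D" "D \<subseteq> carrier V" "card D \<le> d" "d \<le> n"
  shows "\<exists>W. subspace K W V \<and> vectorspace.dim K (vs W) = d \<and> D \<subseteq> W"
  using indep_set_spanning[OF assms] dim_span_indep span_is_subspace by metis

text \<open>
  Translate so that \<open>p\<close> is the origin. The dependence then expresses one further point \<open>r\<close> with nonzero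
  coefficient through the remaining points, at most \<open>d\<close> in number, and any subspace that
  contains these also contains \<open>r\<close>. Such an \<open>r\<close> exists because the coefficients sum to zero.
\<close>

lemma affine_dependence_coset:
  assumes K: "finite (carrier K)" and V: "card (carrier V) = card (carrier K) ^ n"
    and B: "finite B" "B \<subseteq> carrier V" "card B \<le> d + 2" and d: "d \<le> n"
    and c: "c \<in> B \<rightarrow> carrier K" and sum0: "(\<Oplus>\<^bsub>K\<^esub>x\<in>B. c x) = \<zero>\<^bsub>K\<^esub>"
    and comb0: "(\<Oplus>\<^bsub>V\<^esub>x\<in>B. c x \<odot>\<^bsub>V\<^esub> x) = \<zero>\<^bsub>V\<^esub>"
    and nz: "p \<in> B" "c p \<noteq> \<zero>\<^bsub>K\<^esub>"
  shows "\<exists>W. subspace K W V \<and> vectorspace.dim K (vs W) = d \<and> B \<subseteq> p <+\<^bsub>V\<^esub> W"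
proof -
  have p: "p \<in> carrier V" using B nz by auto
  have cB: "c x \<in> carrier K" "x \<in> carrier V" if "x \<in> B" for x using c B that by auto
  have "\<exists>r\<in>B - {p}. c r \<noteq> \<zero>\<^bsub>K\<^esub>"
  proof (rule ccontr)
    assume "\<not> ?thesis"
    then have "(\<Oplus>\<^bsub>K\<^esub>x\<in>B - {p}. c x) = (\<Oplus>\<^bsub>K\<^esub>x\<in>B - {p}. \<zero>\<^bsub>K\<^esub>)"
      using cB by (intro R.finsum_cong') auto
    moreover have "(\<Oplus>\<^bsub>K\<^esub>x\<in>insert p (B - {p}). c x) = c p \<oplus>\<^bsub>K\<^esub> (\<Oplus>\<^bsub>K\<^esub>x\<in>B - {p}. c x)"
      using B(1) cB nz(1) by (intro R.finsum_insert) auto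
    ultimately show False using sum0 nz cB by (simp add: insert_absorb)
  qed
  then obtain r where r: "r \<in> B" "r \<noteq> p" "c r \<noteq> \<zero>\<^bsub>K\<^esub>" by auto
  define R where "R = B - {p, r}"
  have R: "finite R" "R \<subseteq> B" "R \<subseteq> carrier V" "card R \<le> d" "p \<notin> R" "r \<notin> R"
    using B nz r by (auto simp: R_def card_Diff_insert)
  have Beq: "B = insert p (insert r R)" using nz r by (auto simp: R_def)
  define e where "e x = x \<ominus>\<^bsub>V\<^esub> p" for x
  have e: "e x \<in> carrier V" if "x \<in> carrier V" for x using that p by (simp add: e_def)
  have "card (e ` R) \<le> d" using card_image_le[OF R(1), of e] R(4) by simp
  then obtain W where W: "subspace K W V" "vectorspace.dim K (vs W) = d" "e ` R \<subseteq> W"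
    using subspace_of_dim_containing[OF K V, of "e ` R" d] d R e by auto
  interpret W: vectorspace K "vs W" by (rule subspace_is_vs[OF W(1)])
  have sub: "submodule K W V" using W(1) by (rule is_module)
  have Wc: "W \<subseteq> carrier V" using sub by (simp add: submodule_def)
  have W_add: "x \<oplus>\<^bsub>V\<^esub> y \<in> W" if "x \<in> W" "y \<in> W" for x y using that W.M.add.m_closed by simp
  have W_smult: "a \<odot>\<^bsub>V\<^esub> x \<in> W" if "a \<in> carrier K" "x \<in> W" for a x
    using that W.smult_closed by simp
  have W_zero: "\<zero>\<^bsub>V\<^esub> \<in> W" using W.M.zero_closed by simp
  have "(\<Oplus>\<^bsub>V\<^esub>x\<in>B. c x \<odot>\<^bsub>V\<^esub> e x) = \<zero>\<^bsub>V\<^esub>"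
  proof -
    have "(\<Oplus>\<^bsub>V\<^esub>x\<in>B. c x \<odot>\<^bsub>V\<^esub> e x) = (\<Oplus>\<^bsub>V\<^esub>x\<in>B. c x \<odot>\<^bsub>V\<^esub> x \<oplus>\<^bsub>V\<^esub> c x \<odot>\<^bsub>V\<^esub> (\<ominus>\<^bsub>V\<^esub> p))"
      using cB p by (intro M.finsum_cong') (auto simp: e_def a_minus_def smult_r_distr)
    also have "\<dots> = (\<Oplus>\<^bsub>V\<^esub>x\<in>B. c x \<odot>\<^bsub>V\<^esub> x) \<oplus>\<^bsub>V\<^esub> (\<Oplus>\<^bsub>V\<^esub>x\<in>B. c x \<odot>\<^bsub>V\<^esub> (\<ominus>\<^bsub>V\<^esub> p))"
      using cB p by (intro M.finsum_addf) auto
    also have "(\<Oplus>\<^bsub>V\<^esub>x\<in>B. c x \<odot>\<^bsub>V\<^esub> (\<ominus>\<^bsub>V\<^esub> p)) = (\<Oplus>\<^bsub>K\<^esub>x\<in>B. c x) \<odot>\<^bsub>V\<^esub> (\<ominus>\<^bsub>V\<^esub> p)"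
      using B(1) c
    proof (induction B rule: finite_induct)
      case (insert x F)
      then have "(\<Oplus>\<^bsub>V\<^esub>x\<in>insert x F. c x \<odot>\<^bsub>V\<^esub> (\<ominus>\<^bsub>V\<^esub> p)) =
          c x \<odot>\<^bsub>V\<^esub> (\<ominus>\<^bsub>V\<^esub> p) \<oplus>\<^bsub>V\<^esub> (\<Oplus>\<^bsub>V\<^esub>x\<in>F. c x \<odot>\<^bsub>V\<^esub> (\<ominus>\<^bsub>V\<^esub> p))"
        using p by (intro M.finsum_insert) auto
      moreover have "(\<Oplus>\<^bsub>K\<^esub>x\<in>insert x F. c x) = c x \<oplus>\<^bsub>K\<^esub> (\<Oplus>\<^bsub>K\<^esub>x\<in>F. c x)"
        using insert by (intro R.finsum_insert) auto
      moreover have "(\<Oplus>\<^bsub>K\<^esub>x\<in>F. c x) \<in> carrier K" using insert by (intro R.finsum_closed) auto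
      ultimately show ?case using insert p by (simp add: smult_l_distr)
    qed (use p in simp)
    finally show ?thesis using comb0 sum0 p by simp
  qed
  also have "(\<Oplus>\<^bsub>V\<^esub>x\<in>B. c x \<odot>\<^bsub>V\<^esub> e x) =
      c p \<odot>\<^bsub>V\<^esub> e p \<oplus>\<^bsub>V\<^esub> (c r \<odot>\<^bsub>V\<^esub> e r \<oplus>\<^bsub>V\<^esub> (\<Oplus>\<^bsub>V\<^esub>x\<in>R. c x \<odot>\<^bsub>V\<^esub> e x))"
  proof -
    have "(\<Oplus>\<^bsub>V\<^esub>x\<in>B. c x \<odot>\<^bsub>V\<^esub> e x) = c p \<odot>\<^bsub>V\<^esub> e p \<oplus>\<^bsub>V\<^esub> (\<Oplus>\<^bsub>V\<^esub>x\<in>insert r R. c x \<odot>\<^bsub>V\<^esub> e x)"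
      unfolding Beq using cB e R r nz by (intro M.finsum_insert) auto
    also have "(\<Oplus>\<^bsub>V\<^esub>x\<in>insert r R. c x \<odot>\<^bsub>V\<^esub> e x) = c r \<odot>\<^bsub>V\<^esub> e r \<oplus>\<^bsub>V\<^esub> (\<Oplus>\<^bsub>V\<^esub>x\<in>R. c x \<odot>\<^bsub>V\<^esub> e x)"
      using cB e R r nz by (intro M.finsum_insert) auto
    finally show ?thesis .
  qed
  also have "c p \<odot>\<^bsub>V\<^esub> e p = \<zero>\<^bsub>V\<^esub>" using p nz cB by (simp add: e_def M.r_neg a_minus_def)
  finally have rel: "\<zero>\<^bsub>V\<^esub> \<oplus>\<^bsub>V\<^esub> (c r \<odot>\<^bsub>V\<^esub> e r \<oplus>\<^bsub>V\<^esub> (\<Oplus>\<^bsub>V\<^esub>x\<in>R. c x \<odot>\<^bsub>V\<^esub> e x)) = \<zero>\<^bsub>V\<^esub>" .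
  define s where "s = (\<Oplus>\<^bsub>V\<^esub>x\<in>R. c x \<odot>\<^bsub>V\<^esub> e x)"
  have sW: "s \<in> W"
  proof -
    have "(\<Oplus>\<^bsub>V\<^esub>x\<in>F. c x \<odot>\<^bsub>V\<^esub> e x) \<in> W" if "finite F" "F \<subseteq> R" for F
      using that
    proof (induction F rule: finite_induct)
      case (insert x F)
      have "(\<Oplus>\<^bsub>V\<^esub>x\<in>insert x F. c x \<odot>\<^bsub>V\<^esub> e x) = c x \<odot>\<^bsub>V\<^esub> e x \<oplus>\<^bsub>V\<^esub> (\<Oplus>\<^bsub>V\<^esub>x\<in>F. c x \<odot>\<^bsub>V\<^esub> e x)"
        using insert R cB e by (intro M.finsum_insert) (auto intro!: smult_closed)
      then show ?case using insert W(3) R cB by (auto intro!: W_add W_smult)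
    qed (simp add: W_zero)
    then show ?thesis using R(1) by (simp add: s_def)
  qed
  have er: "e r \<in> carrier V" using e cB r by blast
  have "c r \<odot>\<^bsub>V\<^esub> e r = \<ominus>\<^bsub>V\<^esub> s"
    using rel sW Wc cB[OF r(1)] er unfolding s_def[symmetric]
    by (intro M.minus_equality[symmetric]) (auto simp: subset_eq)
  moreover have "\<ominus>\<^bsub>V\<^esub> s = (\<ominus>\<^bsub>K\<^esub> \<one>\<^bsub>K\<^esub>) \<odot>\<^bsub>V\<^esub> s" using smult_minus_1[of s] sW Wc by auto
  ultimately have "c r \<odot>\<^bsub>V\<^esub> e r \<in> W" using W_smult[OF _ sW] by simp
  moreover have "inv\<^bsub>K\<^esub> (c r) \<in> carrier K" using cB r field_Units by auto
  ultimately have "inv\<^bsub>K\<^esub> (c r) \<odot>\<^bsub>V\<^esub> (c r \<odot>\<^bsub>V\<^esub> e r) \<in> W" by (rule W_smult[rotated])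
  then have eW: "e r \<in> W" using mult_inverse[of "c r" "e r"] cB er r by auto
  have "x \<in> p <+\<^bsub>V\<^esub> W" if "x \<in> B" for x
  proof -
    have "e x \<in> W" using that W(3) eW W_zero p by (auto simp: Beq e_def a_minus_def M.r_neg)
    moreover have "x = p \<oplus>\<^bsub>V\<^esub> e x"
      using cB(2)[OF that] p M.a_lcomm[of p x "\<ominus>\<^bsub>V\<^esub> p"]
      by (simp add: e_def a_minus_def M.r_neg)
    ultimately show ?thesis by (auto simp: a_l_coset_def')
  qed
  then show ?thesis using W by auto
qed

end

text \<open>
  \<^const>\<open>AG\<close> takes a plain ring record without further fields, which fixes the type of \<open>R\<close>.
\<close>

locale finite_field = field R for R :: "'a ring" (structure) +
  assumes finite_carrier: "finite (carrier R)"
begin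

lemma AG_simps:
  "carrier (AG R n) = {..<n} \<rightarrow>\<^sub>E carrier R"
  "\<zero>\<^bsub>AG R n\<^esub> = (\<lambda>i\<in>{..<n}. \<zero>)"
  "x \<oplus>\<^bsub>AG R n\<^esub> y = (\<lambda>i\<in>{..<n}. x i \<oplus> y i)"
  "a \<odot>\<^bsub>AG R n\<^esub> x = (\<lambda>i\<in>{..<n}. a \<otimes> x i)"
  by (simp_all add: AG_def func_space_def)

lemma AG_vectorspace: "vectorspace R (AG R n)"
  unfolding vectorspace_def AG_def using func_space_is_module field_axioms by blast

lemma card_AG: "card (carrier (AG R n)) = card (carrier R) ^ n"
  by (simp add: AG_simps card_PiE)

lemma AG_coord: "x \<in> carrier (AG R n) \<Longrightarrow> i < n \<Longrightarrow> x i \<in> carrier R"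
  by (auto simp: AG_simps)

lemma AG_finsum_coord:
  assumes "finite B" "f \<in> B \<rightarrow> carrier (AG R n)" "i < n"
  shows "(\<Oplus>\<^bsub>AG R n\<^esub>x\<in>B. f x) i = (\<Oplus>x\<in>B. f x i)"
  using assms(1,2)
proof (induction B rule: finite_induct)
  interpret V: vectorspace R "AG R n" by (rule AG_vectorspace)
  case empty
  then show ?case using assms(3) by (simp add: AG_simps)
next
  interpret V: vectorspace R "AG R n" by (rule AG_vectorspace)
  case (insert x F)
  then have "(\<Oplus>\<^bsub>AG R n\<^esub>x\<in>insert x F. f x) = f x \<oplus>\<^bsub>AG R n\<^esub> (\<Oplus>\<^bsub>AG R n\<^esub>x\<in>F. f x)"
    by (intro V.M.finsum_insert) auto
  moreover have "(\<Oplus>x\<in>insert x F. f x i) = f x i \<oplus> (\<Oplus>x\<in>F. f x i)"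
    using insert assms(3) by (intro finsum_insert) (auto intro: AG_coord)
  ultimately show ?case using insert assms(3) by (simp add: AG_simps)
qed

lemma AG_eqI:
  assumes "x \<in> carrier (AG R n)" "y \<in> carrier (AG R n)" "\<And>i. i < n \<Longrightarrow> x i = y i"
  shows "x = y"
  using assms by (auto simp: AG_simps intro: PiE_ext)

text \<open>
  The form in which \<open>m\<close>-generality is used. A nontrivial dependence on \<open>B\<close> is extended by zero to exactly \<open>m\<close> points
  of \<open>A\<close>, which is possible because \<open>A\<close> has more than \<open>m\<close> points; these would then lie on a common
  \<open>(m-2)\<close>-flat.
\<close>

lemma m_general_affinely_independent:
  assumes m: "3 \<le> m" "m \<le> n + 2" and A: "m_general m R n A"
    and B: "B \<subseteq> A" "card B \<le> m"
    and c: "c \<in> B \<rightarrow> carrier R" "(\<Oplus>x\<in>B. c x) = \<zero>" "\<And>i. i < n \<Longrightarrow> (\<Oplus>x\<in>B. c x \<otimes> x i) = \<zero>"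
    and p: "p \<in> B"
  shows "c p = \<zero>"
proof (rule ccontr)
  assume nz: "c p \<noteq> \<zero>"
  interpret V: vectorspace R "AG R n" by (rule AG_vectorspace)
  have A': "A \<subseteq> carrier (AG R n)" "m < card A" using A by (auto simp: m_general_def)
  then have "finite A" by (simp add: card_ge_0_finite)
  then obtain B' where B': "B \<subseteq> B'" "B' \<subseteq> A" "card B' = m"
    using exists_subset_between[of B m A] B A' by auto
  have fB: "finite B'" using B' \<open>finite A\<close> finite_subset by blast
  have B'V: "x \<in> carrier (AG R n)" if "x \<in> B'" for x using that B' A' by auto
  have B'c: "x i \<in> carrier R" if "x \<in> B'" "i < n" for x i using AG_coord[OF B'V] that .
  define c' where "c' x = (if x \<in> B then c x else \<zero>)" for x
  have c': "c' x \<in> carrier R" for x using c(1) by (auto simp: c'_def)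
  have ext: "(\<Oplus>x\<in>B'. c' x \<otimes> f x) = (\<Oplus>x\<in>B. c x \<otimes> f x)" if "f \<in> B' \<rightarrow> carrier R" for f
  proof -
    have "c x \<in> carrier R" "f x \<in> carrier R" if "x \<in> B" for x
      using that \<open>f \<in> B' \<rightarrow> carrier R\<close> B' c(1) by auto
    then show ?thesis
      using that B' fB finite_subset[OF B'(1) fB]
      by (intro add.finprod_mono_neutral_cong) (auto simp: c'_def Pi_iff)
  qed
  have "(\<Oplus>x\<in>B'. c' x) = (\<Oplus>x\<in>B'. c' x \<otimes> \<one>)" using c' by (intro finsum_cong') auto
  also have "\<dots> = (\<Oplus>x\<in>B. c x \<otimes> \<one>)" by (rule ext) auto
  also have "\<dots> = (\<Oplus>x\<in>B. c x)" using c(1) by (intro finsum_cong') (auto simp: Pi_iff)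
  finally have s1: "(\<Oplus>x\<in>B'. c' x) = \<zero>" using c(2) by simp
  have comb0: "(\<Oplus>\<^bsub>AG R n\<^esub>x\<in>B'. c' x \<odot>\<^bsub>AG R n\<^esub> x) = \<zero>\<^bsub>AG R n\<^esub>"
  proof (rule AG_eqI)
    show "(\<Oplus>\<^bsub>AG R n\<^esub>x\<in>B'. c' x \<odot>\<^bsub>AG R n\<^esub> x) \<in> carrier (AG R n)"
      using B'V c' by (intro V.M.finsum_closed) auto
    fix i assume i: "i < n"
    have "(\<Oplus>\<^bsub>AG R n\<^esub>x\<in>B'. c' x \<odot>\<^bsub>AG R n\<^esub> x) i = (\<Oplus>x\<in>B'. (c' x \<odot>\<^bsub>AG R n\<^esub> x) i)"
      using B'V c' fB i by (intro AG_finsum_coord) auto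
    also have "\<dots> = (\<Oplus>x\<in>B'. c' x \<otimes> x i)"
      using B'c c' i by (intro finsum_cong') (auto simp: AG_simps(4))
    also have "\<dots> = (\<Oplus>x\<in>B. c x \<otimes> x i)"
      using B'c i by (intro ext) auto
    finally show "(\<Oplus>\<^bsub>AG R n\<^esub>x\<in>B'. c' x \<odot>\<^bsub>AG R n\<^esub> x) i = \<zero>\<^bsub>AG R n\<^esub> i"
      using c(3)[OF i] i by (simp add: AG_simps)
  qed simp
  have "\<exists>W. subspace R W (AG R n) \<and> vectorspace.dim R (V.vs W) = m - 2 \<and>
      B' \<subseteq> p <+\<^bsub>AG R n\<^esub> W"
  proof (rule V.affine_dependence_coset[OF finite_carrier card_AG fB])
    show "B' \<subseteq> carrier (AG R n)" using B'V by (rule subsetI)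
    show "card B' \<le> m - 2 + 2" "m - 2 \<le> n" using B'(3) m by simp_all
    show "c' \<in> B' \<rightarrow> carrier R" using c' by (rule Pi_I)
    show "p \<in> B'" using p B'(1) by (rule rev_subsetD)
    show "c' p \<noteq> \<zero>" using p nz by (simp add: c'_def)
  qed (rule s1 comb0)+
  then obtain W where W: "subspace R W (AG R n)" "vectorspace.dim R (AG R n\<lparr>carrier := W\<rparr>) = m - 2"
    "B' \<subseteq> p <+\<^bsub>AG R n\<^esub> W" by auto
  have flat: "is_flat R n (m - 2) (p <+\<^bsub>AG R n\<^esub> W)"
    unfolding is_flat_def
  proof (intro exI conjI)
    show "p \<in> carrier (AG R n)" using p B'(1) by (intro B'V) auto
  qed (rule W(1) W(2) refl)+
  have "\<And>B S. B \<subseteq> A \<Longrightarrow> card B = m \<Longrightarrow> is_flat R n (m - 2) S \<Longrightarrow> B \<subseteq> S \<Longrightarrow> False"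
    using A unfolding m_general_def by metis
  then show False using B'(2,3) flat W(3) by metis
qed

text \<open>
  Sums of \<open>m div 2\<close> points of \<open>A\<close> are pairwise distinct: if \<open>S\<close> and \<open>T\<close> have equal sums, then
  the coefficients \<open>1\<close> on \<open>S - T\<close> and \<open>-1\<close> on \<open>T - S\<close> form an affine dependence among at most \<open>m\<close>
  points.
\<close>

lemma choose_half_le:
  assumes m: "3 \<le> m" "m \<le> n + 2" and A: "m_general m R n A"
  shows "card A choose (m div 2) \<le> card (carrier R) ^ n"
proof -
  interpret V: vectorspace R "AG R n" by (rule AG_vectorspace)
  define k where "k = m div 2"
  have A': "A \<subseteq> carrier (AG R n)" "m < card A" using A by (auto simp: m_general_def)
  then have fA: "finite A" by (simp add: card_ge_0_finite)
  define P where "P = {S. S \<subseteq> A \<and> card S = k}"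
  define \<sigma> where "\<sigma> S = (\<Oplus>\<^bsub>AG R n\<^esub>x\<in>S. x)" for S
  have \<sigma>: "\<sigma> S \<in> carrier (AG R n)" if "S \<subseteq> A" for S
    using that A' unfolding \<sigma>_def by (intro V.M.finsum_closed) auto
  have "inj_on \<sigma> P"
  proof (rule inj_onI)
    fix S T assume "S \<in> P" "T \<in> P" and eq: "\<sigma> S = \<sigma> T"
    then have S: "S \<subseteq> A" "card S = k" "finite S" and T: "T \<subseteq> A" "card T = k" "finite T"
      using fA finite_subset by (auto simp: P_def)
    have xi: "x i \<in> carrier R" if "x \<in> A" "i < n" for x i using that A' by (auto intro: AG_coord)
    define B where "B = (S - T) \<union> (T - S)"
    define c where "c x = (if x \<in> S then \<one> else \<ominus> \<one>)" for x
    have card_diff: "card (S - T) = card (T - S)"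
      using card_le_sym_Diff[OF S(3) T(3)] card_le_sym_Diff[OF T(3) S(3)] S(2) T(2) by simp
    have split: "(\<Oplus>x\<in>B. c x \<otimes> f x) = (\<Oplus>x\<in>S - T. f x) \<ominus> (\<Oplus>x\<in>T - S. f x)"
      if f: "f \<in> A \<rightarrow> carrier R" for f
    proof -
      have fc: "f x \<in> carrier R" if "x \<in> S \<or> x \<in> T" for x using f S T that by auto
      have "(\<Oplus>x\<in>B. c x \<otimes> f x) = (\<Oplus>x\<in>S - T. c x \<otimes> f x) \<oplus> (\<Oplus>x\<in>T - S. c x \<otimes> f x)"
        unfolding B_def using S T fc by (intro finsum_Un_disjoint) (auto simp: c_def)
      also have "(\<Oplus>x\<in>S - T. c x \<otimes> f x) = (\<Oplus>x\<in>S - T. f x)"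
        using fc by (intro finsum_cong') (auto simp: c_def)
      also have "(\<Oplus>x\<in>T - S. c x \<otimes> f x) = (\<Oplus>x\<in>T - S. \<ominus> \<one> \<otimes> f x)"
        using fc by (intro finsum_cong') (auto simp: c_def)
      also have "\<dots> = \<ominus> \<one> \<otimes> (\<Oplus>x\<in>T - S. f x)"
        using fc T by (intro finsum_rdistr[symmetric]) auto
      finally show ?thesis
        using fc by (simp add: a_minus_def l_minus)
    qed
    have diff: "(\<Oplus>x\<in>S - T. f x) = (\<Oplus>x\<in>T - S. f x)"
      if f: "f \<in> A \<rightarrow> carrier R" and e: "(\<Oplus>x\<in>S. f x) = (\<Oplus>x\<in>T. f x)" for f
    proof -
      have fc: "f x \<in> carrier R" if "x \<in> S \<or> x \<in> T" for x using f S T that by auto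
      have "(\<Oplus>x\<in>(S - T) \<union> (S \<inter> T). f x) = (\<Oplus>x\<in>S - T. f x) \<oplus> (\<Oplus>x\<in>S \<inter> T. f x)"
        using S T fc by (intro finsum_Un_disjoint) auto
      moreover have "(\<Oplus>x\<in>(T - S) \<union> (S \<inter> T). f x) = (\<Oplus>x\<in>T - S. f x) \<oplus> (\<Oplus>x\<in>S \<inter> T. f x)"
        using S T fc by (intro finsum_Un_disjoint) auto
      moreover have "(S - T) \<union> (S \<inter> T) = S" "(T - S) \<union> (S \<inter> T) = T" by auto
      ultimately have "(\<Oplus>x\<in>S - T. f x) \<oplus> (\<Oplus>x\<in>S \<inter> T. f x) = (\<Oplus>x\<in>T - S. f x) \<oplus> (\<Oplus>x\<in>S \<inter> T. f x)"
        using e by simp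
      then show ?thesis using fc by (simp add: add.right_cancel)
    qed
    have vanish: "(\<Oplus>x\<in>B. c x \<otimes> f x) = \<zero>"
      if f: "f \<in> A \<rightarrow> carrier R" and e: "(\<Oplus>x\<in>S - T. f x) = (\<Oplus>x\<in>T - S. f x)" for f
    proof -
      have "(\<Oplus>x\<in>T - S. f x) \<in> carrier R" using f T by (intro finsum_closed) auto
      then show ?thesis unfolding split[OF f] e by (simp add: a_minus_def r_neg)
    qed
    have "B = {}"
    proof (rule ccontr)
      assume "B \<noteq> {}"
      then obtain p where p: "p \<in> B" by auto
      have "c p = \<zero>"
      proof (rule m_general_affinely_independent[OF m A _ _ _ _ _ p])
        show "B \<subseteq> A" using S T by (auto simp: B_def)
        have "card B \<le> card (S - T) + card (T - S)" unfolding B_def by (rule card_Un_le)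
        also have "\<dots> \<le> k + k"
          using card_mono[OF S(3) Diff_subset[of S T]] card_mono[OF T(3) Diff_subset[of T S]] S(2) T(2)
          by simp
        finally show "card B \<le> m" by (simp add: k_def)
        show "c \<in> B \<rightarrow> carrier R" by (auto simp: c_def)
        have "(\<Oplus>x\<in>B. c x \<otimes> \<one>) = \<zero>"
          using card_diff by (intro vanish) (auto simp: add.finprod_const)
        moreover have "(\<Oplus>x\<in>B. c x \<otimes> \<one>) = (\<Oplus>x\<in>B. c x)" by (intro finsum_cong') (auto simp: c_def)
        ultimately show "(\<Oplus>x\<in>B. c x) = \<zero>" by simp
        fix i assume i: "i < n"
        have "(\<Oplus>x\<in>S. x i) = (\<Oplus>x\<in>T. x i)"
        proof -
          have "\<sigma> X i = (\<Oplus>x\<in>X. x i)" if "X \<subseteq> A" "finite X" for X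
            unfolding \<sigma>_def using that A' by (intro AG_finsum_coord[OF _ _ i]) auto
          then show ?thesis using eq S T by metis
        qed
        then show "(\<Oplus>x\<in>B. c x \<otimes> x i) = \<zero>"
          using xi i by (intro vanish diff) auto
      qed
      moreover have "\<ominus> \<one> \<noteq> \<zero>" 
      proof
        assume "\<ominus> \<one> = \<zero>"
        then have "\<ominus> (\<ominus> \<one>) = \<ominus> \<zero>" by simp
        then show False by simp
      qed
      ultimately show False by (simp add: c_def split: if_splits)
    qed
    then show "S = T" by (auto simp: B_def)
  qed
  then have "card P = card (\<sigma> ` P)" by (simp add: card_image)
  also have "\<dots> \<le> card (carrier (AG R n))"
    using \<sigma> finite_carrier by (intro card_mono) (auto simp: P_def AG_simps(1) intro: finite_PiE)
  finally show ?thesis using n_subsets[OF fA, of k] by (simp add: P_def k_def card_AG)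
qed

section \<open>The slice rank of a diagonal tensor\<close>

lemma finsum_pairing_swap:
  assumes "finite S" "finite U" "h \<in> S \<rightarrow> carrier R" "a \<in> U \<rightarrow> carrier R"
    and "\<And>u z. u \<in> U \<Longrightarrow> z \<in> S \<Longrightarrow> b u z \<in> carrier R"
  shows "(\<Oplus>z\<in>S. h z \<otimes> (\<Oplus>u\<in>U. b u z \<otimes> a u)) = (\<Oplus>u\<in>U. (\<Oplus>z\<in>S. h z \<otimes> b u z) \<otimes> a u)"
  using assms(2,4,5)
proof (induction U rule: finite_induct)
  case empty
  have "(\<Oplus>z\<in>S. h z \<otimes> \<zero>) = (\<Oplus>z\<in>S. \<zero>)" using assms(3) by (intro finsum_cong') (auto simp: Pi_iff)
  then show ?case by simp
next
  case (insert u F)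
  have h: "h z \<in> carrier R" if "z \<in> S" for z using assms(3) that by auto
  have b: "b v z \<in> carrier R" if "v \<in> insert u F" "z \<in> S" for v z using insert.prems(2) that by blast
  have a: "a v \<in> carrier R" if "v \<in> insert u F" for v using insert.prems(1) that by auto
  have inner: "(\<Oplus>v\<in>F. b v z \<otimes> a v) \<in> carrier R" if "z \<in> S" for z
    using that a b by (intro finsum_closed) auto
  have "(\<Oplus>z\<in>S. h z \<otimes> (\<Oplus>v\<in>insert u F. b v z \<otimes> a v)) =
      (\<Oplus>z\<in>S. (h z \<otimes> b u z) \<otimes> a u \<oplus> h z \<otimes> (\<Oplus>v\<in>F. b v z \<otimes> a v))"
  proof (intro finsum_cong')
    fix z assume z: "z \<in> S"
    have "(\<Oplus>v\<in>insert u F. b v z \<otimes> a v) = b u z \<otimes> a u \<oplus> (\<Oplus>v\<in>F. b v z \<otimes> a v)"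
      using insert.hyps a b z by (intro finsum_insert) auto
    then show "h z \<otimes> (\<Oplus>v\<in>insert u F. b v z \<otimes> a v) =
        (h z \<otimes> b u z) \<otimes> a u \<oplus> h z \<otimes> (\<Oplus>v\<in>F. b v z \<otimes> a v)"
      using h[OF z] b[OF _ z] a inner[OF z] by (simp add: r_distr m_assoc)
  qed (use h a b inner in auto)
  also have "\<dots> = (\<Oplus>z\<in>S. (h z \<otimes> b u z) \<otimes> a u) \<oplus> (\<Oplus>z\<in>S. h z \<otimes> (\<Oplus>v\<in>F. b v z \<otimes> a v))"
    using h a b inner by (intro finsum_addf) auto
  also have "(\<Oplus>z\<in>S. (h z \<otimes> b u z) \<otimes> a u) = (\<Oplus>z\<in>S. h z \<otimes> b u z) \<otimes> a u"
    using h a b assms(1) by (intro finsum_ldistr[symmetric]) auto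
  also have "(\<Oplus>z\<in>S. h z \<otimes> (\<Oplus>v\<in>F. b v z \<otimes> a v)) = (\<Oplus>v\<in>F. (\<Oplus>z\<in>S. h z \<otimes> b v z) \<otimes> a v)"
    using a b by (intro insert.IH) auto
  also have "(\<Oplus>z\<in>S. h z \<otimes> b u z) \<otimes> a u \<oplus> \<dots> = (\<Oplus>v\<in>insert u F. (\<Oplus>z\<in>S. h z \<otimes> b v z) \<otimes> a v)"
    using insert.hyps a b h by (intro finsum_insert[symmetric]) (auto intro!: m_closed finsum_closed)
  finally show ?case .
qed

lemma finsum_pairing_zero:
  assumes "finite S" "finite U" "h \<in> S \<rightarrow> carrier R" "a \<in> U \<rightarrow> carrier R"
    and "\<And>u z. u \<in> U \<Longrightarrow> z \<in> S \<Longrightarrow> b u z \<in> carrier R"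
    and "\<And>u. u \<in> U \<Longrightarrow> (\<Oplus>z\<in>S. h z \<otimes> b u z) = \<zero>"
  shows "(\<Oplus>z\<in>S. h z \<otimes> (\<Oplus>u\<in>U. b u z \<otimes> a u)) = \<zero>"
proof -
  have "(\<Oplus>u\<in>U. (\<Oplus>z\<in>S. h z \<otimes> b u z) \<otimes> a u) = (\<Oplus>u\<in>U. \<zero>)"
    using assms(4,6) by (intro finsum_cong') (auto simp: Pi_iff)
  then show ?thesis using finsum_pairing_swap[OF assms(1-5)] by simp
qed

lemma card_carrier_ge_2: "2 \<le> card (carrier R)"
  using card_mono[OF finite_carrier, of "{\<zero>, \<one>}"] by simp

lemma finsum_pairing_add:
  assumes "g \<in> S \<rightarrow> carrier R" "h \<in> S \<rightarrow> carrier R" "f \<in> S \<rightarrow> carrier R"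
  shows "(\<Oplus>s\<in>S. (g s \<oplus> h s) \<otimes> f s) = (\<Oplus>s\<in>S. g s \<otimes> f s) \<oplus> (\<Oplus>s\<in>S. h s \<otimes> f s)"
proof -
  have "(\<Oplus>s\<in>S. (g s \<oplus> h s) \<otimes> f s) = (\<Oplus>s\<in>S. g s \<otimes> f s \<oplus> h s \<otimes> f s)"
    using assms by (intro finsum_cong') (auto simp: l_distr Pi_iff)
  also have "\<dots> = (\<Oplus>s\<in>S. g s \<otimes> f s) \<oplus> (\<Oplus>s\<in>S. h s \<otimes> f s)"
    using assms by (intro finsum_addf) auto
  finally show ?thesis .
qed

text \<open>
  Fewer linear conditions than unknowns have a nonzero solution. Over a finite field this is the
  pigeonhole principle: two coefficient functions satisfy the conditions with the same values, and their difference
  is a solution.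
\<close>

lemma annihilator_exists:
  assumes S: "finite S" and J: "finite J" "card J < card S"
    and \<phi>: "\<And>j s. j \<in> J \<Longrightarrow> s \<in> S \<Longrightarrow> \<phi> j s \<in> carrier R"
  shows "\<exists>g\<in>S \<rightarrow> carrier R. (\<exists>s\<in>S. g s \<noteq> \<zero>) \<and> (\<forall>j\<in>J. (\<Oplus>s\<in>S. g s \<otimes> \<phi> j s) = \<zero>)"
proof -
  define \<Phi> where "\<Phi> g = (\<lambda>j\<in>J. \<Oplus>s\<in>S. g s \<otimes> \<phi> j s)" for g
  have cl: "(\<Oplus>s\<in>S. g s \<otimes> \<phi> j s) \<in> carrier R" if "g \<in> S \<rightarrow> carrier R" "j \<in> J" for g j
    using that \<phi> by (intro finsum_closed) auto
  have "\<not> inj_on \<Phi> (S \<rightarrow>\<^sub>E carrier R)"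
  proof
    assume "inj_on \<Phi> (S \<rightarrow>\<^sub>E carrier R)"
    moreover have "\<Phi> ` (S \<rightarrow>\<^sub>E carrier R) \<subseteq> J \<rightarrow>\<^sub>E carrier R"
      using cl by (auto simp: \<Phi>_def PiE_iff)
    moreover have "finite (J \<rightarrow>\<^sub>E carrier R)" using J finite_carrier by (auto intro: finite_PiE)
    ultimately have "card (S \<rightarrow>\<^sub>E carrier R) \<le> card (J \<rightarrow>\<^sub>E carrier R)" by (rule card_inj_on_le)
    moreover have "card (carrier R) ^ card J < card (carrier R) ^ card S"
      using card_carrier_ge_2 J by (intro power_strict_increasing) auto
    ultimately show False using S J by (simp add: card_PiE)
  qed
  then obtain g1 g2 where g: "g1 \<in> S \<rightarrow>\<^sub>E carrier R" "g2 \<in> S \<rightarrow>\<^sub>E carrier R" "g1 \<noteq> g2" "\<Phi> g1 = \<Phi> g2"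
    unfolding inj_on_def by blast
  then obtain s where s: "s \<in> S" "g1 s \<noteq> g2 s" by (meson PiE_ext)
  have gc: "g1 x \<in> carrier R" "g2 x \<in> carrier R" if "x \<in> S" for x using g that by auto
  define g where "g x = g1 x \<ominus> g2 x" for x
  show ?thesis
  proof (intro bexI[of _ g] conjI ballI)
    show "g \<in> S \<rightarrow> carrier R" using gc by (auto simp: g_def)
    show "\<exists>s\<in>S. g s \<noteq> \<zero>" using s gc by (intro bexI[of _ s]) (auto simp: g_def)
    fix j assume j: "j \<in> J"
    define a where "a = (\<Oplus>s\<in>S. g1 s \<otimes> \<phi> j s)"
    have a: "a \<in> carrier R" unfolding a_def using gc j by (intro cl) auto
    have a2: "(\<Oplus>s\<in>S. g2 s \<otimes> \<phi> j s) = a"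
      using fun_cong[OF g(4), of j] j by (simp add: \<Phi>_def a_def)
    have eq: "a = (\<Oplus>s\<in>S. (g s \<oplus> g2 s) \<otimes> \<phi> j s)"
      unfolding a_def using gc \<phi> j by (intro finsum_cong') (auto simp: g_def a_minus_def a_assoc l_neg)
    also have "\<dots> = (\<Oplus>s\<in>S. g s \<otimes> \<phi> j s) \<oplus> (\<Oplus>s\<in>S. g2 s \<otimes> \<phi> j s)"
      using gc \<phi> j by (intro finsum_pairing_add) (auto simp: g_def)
    finally have "(\<Oplus>s\<in>S. g s \<otimes> \<phi> j s) \<oplus> a = a" by (simp add: a2)
    moreover have "(\<Oplus>s\<in>S. g s \<otimes> \<phi> j s) \<in> carrier R" using gc j by (intro cl) (auto simp: g_def)
    ultimately show "(\<Oplus>s\<in>S. g s \<otimes> \<phi> j s) = \<zero>" using a by simp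
  qed
qed

text \<open>
  Take a solution \<open>h\<close> of maximal support. If it vanished at more than \<open>card U\<close> points, some nonzero solution would be
  supported on those points alone, and adding it to \<open>h\<close> would enlarge the support.
\<close>

lemma annihilator_large_support:
  assumes A: "finite A" and U: "finite U"
    and f: "\<And>u x. u \<in> U \<Longrightarrow> x \<in> A \<Longrightarrow> f u x \<in> carrier R"
  shows "\<exists>h\<in>A \<rightarrow> carrier R. (\<forall>u\<in>U. (\<Oplus>x\<in>A. h x \<otimes> f u x) = \<zero>) \<and>
    card A \<le> card {x \<in> A. h x \<noteq> \<zero>} + card U"
proof -
  define P where "P h \<longleftrightarrow> h \<in> A \<rightarrow> carrier R \<and> (\<forall>u\<in>U. (\<Oplus>x\<in>A. h x \<otimes> f u x) = \<zero>)" for h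
  define supp where "supp h = {x \<in> A. h x \<noteq> \<zero>}" for h :: "_ \<Rightarrow> 'a"
  have "P (\<lambda>_. \<zero>)"
  proof -
    have "(\<Oplus>x\<in>A. \<zero> \<otimes> f u x) = (\<Oplus>x\<in>A. \<zero>)" if "u \<in> U" for u
      using that f by (intro finsum_cong') auto
    then show ?thesis by (auto simp: P_def)
  qed
  moreover have "\<forall>h. P h \<longrightarrow> card (supp h) < Suc (card A)"
    using A by (auto simp: supp_def less_Suc_eq_le intro: card_mono)
  ultimately obtain h where h: "P h" "\<And>h'. P h' \<Longrightarrow> card (supp h') \<le> card (supp h)"
    using ex_has_greatest_nat[of P "\<lambda>_. \<zero>" "\<lambda>h. card (supp h)" "Suc (card A)"]
    by blast
  have hc: "h x \<in> carrier R" if "x \<in> A" for x using h(1) that by (auto simp: P_def)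
  have "card (A - supp h) \<le> card U"
  proof (rule ccontr)
    assume "\<not> ?thesis"
    then have lt: "card U < card (A - supp h)" by simp
    have "\<exists>g\<in>A - supp h \<rightarrow> carrier R. (\<exists>s\<in>A - supp h. g s \<noteq> \<zero>) \<and>
        (\<forall>u\<in>U. (\<Oplus>x\<in>A - supp h. g x \<otimes> f u x) = \<zero>)"
      using A U f lt by (intro annihilator_exists) auto
    then obtain g s where g: "g \<in> A - supp h \<rightarrow> carrier R" "s \<in> A - supp h" "g s \<noteq> \<zero>"
      "\<And>u. u \<in> U \<Longrightarrow> (\<Oplus>x\<in>A - supp h. g x \<otimes> f u x) = \<zero>"
      by blast
    define g' where "g' x = (if x \<in> A - supp h then g x else \<zero>)" for x
    have g'c: "g' x \<in> carrier R" for x using g(1) by (auto simp: g'_def)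
    have "P (\<lambda>x. h x \<oplus> g' x)"
      unfolding P_def
    proof (intro conjI ballI)
      show "(\<lambda>x. h x \<oplus> g' x) \<in> A \<rightarrow> carrier R" using hc g'c by auto
      fix u assume u: "u \<in> U"
      have "(\<Oplus>x\<in>A. (h x \<oplus> g' x) \<otimes> f u x) = (\<Oplus>x\<in>A. h x \<otimes> f u x) \<oplus> (\<Oplus>x\<in>A. g' x \<otimes> f u x)"
        using hc g'c f u by (intro finsum_pairing_add) auto
      also have "(\<Oplus>x\<in>A. g' x \<otimes> f u x) = (\<Oplus>x\<in>A - supp h. g x \<otimes> f u x)"
        using A f u g(1) by (intro add.finprod_mono_neutral_cong_right) (auto simp: g'_def Pi_iff)
      finally show "(\<Oplus>x\<in>A. (h x \<oplus> g' x) \<otimes> f u x) = \<zero>" using g(4) u h(1) by (simp add: P_def)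
    qed
    then have "card (supp (\<lambda>x. h x \<oplus> g' x)) \<le> card (supp h)" by (rule h(2))
    moreover have "supp h \<subset> supp (\<lambda>x. h x \<oplus> g' x)"
    proof
      show "supp h \<subseteq> supp (\<lambda>x. h x \<oplus> g' x)" using hc by (auto simp: supp_def g'_def)
      have "s \<in> supp (\<lambda>x. h x \<oplus> g' x) - supp h" 
        using g(2,3) g'c[of s] by (auto simp: supp_def g'_def)
      then show "supp h \<noteq> supp (\<lambda>x. h x \<oplus> g' x)" by auto
    qed
    ultimately show False
      using psubset_card_mono[of "supp (\<lambda>x. h x \<oplus> g' x)" "supp h"] A by (simp add: supp_def)
  qed
  moreover have "card (A - supp h) = card A - card (supp h)"
    using A by (intro card_Diff_subset) (auto simp: supp_def)
  ultimately show ?thesis using h(1) by (intro bexI[of _ h]) (auto simp: P_def supp_def)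
qed

text \<open>
  Contracting the third variable with \<open>h\<close> that annihilates every \<open>f u\<close> removes the third kind of slices
  and turns the diagonal tensor into a diagonal matrix with entries \<open>h\<close>. Its nonzero part \<open>S\<close> has size at
  least \<open>card A - card U\<close>, but it is a sum of \<open>2 card U\<close> matrices of rank one. If \<open>S\<close> were larger than
  that, some nonzero vector \<open>g\<close> on \<open>S\<close> would be orthogonal to all of them, although the diagonal matrix
  is invertible on \<open>S\<close>.
\<close>

lemma slice_rank_diagonal:
  assumes A: "finite A" and U: "finite U"
    and f: "\<And>u x. u \<in> U \<Longrightarrow> x \<in> A \<Longrightarrow> f u x \<in> carrier R"
    and G: "\<And>u x y. u \<in> U \<Longrightarrow> x \<in> A \<Longrightarrow> y \<in> A \<Longrightarrow> G u x y \<in> carrier R"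
    and H: "\<And>u x y. u \<in> U \<Longrightarrow> x \<in> A \<Longrightarrow> y \<in> A \<Longrightarrow> H u x y \<in> carrier R"
    and L: "\<And>u x y. u \<in> U \<Longrightarrow> x \<in> A \<Longrightarrow> y \<in> A \<Longrightarrow> L u x y \<in> carrier R"
    and T: "\<And>x y z. x \<in> A \<Longrightarrow> y \<in> A \<Longrightarrow> z \<in> A \<Longrightarrow>
      (if x = y \<and> y = z then \<one> else \<zero>) =
        (\<Oplus>u\<in>U. G u y z \<otimes> f u x) \<oplus> ((\<Oplus>u\<in>U. H u x z \<otimes> f u y) \<oplus> (\<Oplus>u\<in>U. L u x y \<otimes> f u z))"
  shows "card A \<le> 3 * card U"
proof (rule ccontr)
  assume not: "\<not> ?thesis"
  have L_comm: "(\<Oplus>u\<in>U. L u x y \<otimes> f u z) = (\<Oplus>u\<in>U. f u z \<otimes> L u x y)"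
    if "x \<in> A" "y \<in> A" "z \<in> A" for x y z
    using that f L by (intro finsum_cong') (auto simp: m_comm)
  from not have big: "3 * card U < card A" by simp
  obtain h where h: "h \<in> A \<rightarrow> carrier R" "\<And>u. u \<in> U \<Longrightarrow> (\<Oplus>x\<in>A. h x \<otimes> f u x) = \<zero>"
    "card A \<le> card {x \<in> A. h x \<noteq> \<zero>} + card U"
    using annihilator_large_support[of A U f, OF A U f] by blast
  have hc: "h x \<in> carrier R" if "x \<in> A" for x using h that by auto
  define S where "S = {x \<in> A. h x \<noteq> \<zero>}"
  have S: "finite S" "S \<subseteq> A" using A by (auto simp: S_def)
  define G' where "G' u y = (\<Oplus>z\<in>A. h z \<otimes> G u y z)" for u y
  define H' where "H' u x = (\<Oplus>z\<in>A. h z \<otimes> H u x z)" for u x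
  have G'c: "G' u y \<in> carrier R" if "u \<in> U" "y \<in> A" for u y
    unfolding G'_def using that G hc by (intro finsum_closed) auto
  have H'c: "H' u x \<in> carrier R" if "u \<in> U" "x \<in> A" for u x
    unfolding H'_def using that H hc by (intro finsum_closed) auto
  define \<phi> where "\<phi> j x = (case j of Inl u \<Rightarrow> f u x | Inr u \<Rightarrow> H' u x)" for j x
  have "card (U <+> U) < card S"
    using h(3) big U by (simp add: card_Plus S_def)
  moreover have "\<phi> j x \<in> carrier R" if "j \<in> U <+> U" "x \<in> S" for j x
    using that S f H'c by (auto simp: \<phi>_def)
  ultimately have "\<exists>g\<in>S \<rightarrow> carrier R. (\<exists>s\<in>S. g s \<noteq> \<zero>) \<and> (\<forall>j\<in>U <+> U. (\<Oplus>x\<in>S. g x \<otimes> \<phi> j x) = \<zero>)"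
    using S U by (intro annihilator_exists) auto
  then obtain g y where g: "g \<in> S \<rightarrow> carrier R" "y \<in> S" "g y \<noteq> \<zero>"
    "\<And>j. j \<in> U <+> U \<Longrightarrow> (\<Oplus>x\<in>S. g x \<otimes> \<phi> j x) = \<zero>"
    by blast
  have y: "y \<in> A" "h y \<noteq> \<zero>" using g(2) by (auto simp: S_def)
  have gf: "(\<Oplus>x\<in>S. g x \<otimes> f u x) = \<zero>" if "u \<in> U" for u
    using g(4)[rule_format, OF InlI[OF that]] by (simp add: \<phi>_def)
  have gH: "(\<Oplus>x\<in>S. g x \<otimes> H' u x) = \<zero>" if "u \<in> U" for u
    using g(4)[rule_format, OF InrI[OF that]] by (simp add: \<phi>_def)
  have gc: "g x \<in> carrier R" if "x \<in> S" for x using g(1) that by auto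
  have contract: "(\<Oplus>u\<in>U. f u x \<otimes> G' u y) \<oplus> (\<Oplus>u\<in>U. H' u x \<otimes> f u y) = (if x = y then h y else \<zero>)"
    if x: "x \<in> A" for x
  proof -
    have c1: "(\<Oplus>u\<in>U. G u y z \<otimes> f u x) \<in> carrier R" if "z \<in> A" for z
      using that x y f G by (intro finsum_closed) auto
    have c2: "(\<Oplus>u\<in>U. H u x z \<otimes> f u y) \<in> carrier R" if "z \<in> A" for z
      using that x y f H by (intro finsum_closed) auto
    have c3: "(\<Oplus>u\<in>U. f u z \<otimes> L u x y) \<in> carrier R" if "z \<in> A" for z
      using that x y f L by (intro finsum_closed) auto
    have "(\<Oplus>z\<in>A. h z \<otimes> (if x = y \<and> y = z then \<one> else \<zero>)) =
        (\<Oplus>z\<in>A. if y = z then (if x = y then h z else \<zero>) else \<zero>)"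
      using hc by (intro finsum_cong') auto
    also have "\<dots> = (if x = y then h y else \<zero>)"
      using y A hc by (intro add.finprod_singleton) auto
    finally have 1: "(\<Oplus>z\<in>A. h z \<otimes> (if x = y \<and> y = z then \<one> else \<zero>)) = (if x = y then h y else \<zero>)" .
    have "(\<Oplus>z\<in>A. h z \<otimes> (if x = y \<and> y = z then \<one> else \<zero>)) =
      (\<Oplus>z\<in>A. h z \<otimes> (\<Oplus>u\<in>U. G u y z \<otimes> f u x) \<oplus>
        (h z \<otimes> (\<Oplus>u\<in>U. H u x z \<otimes> f u y) \<oplus> h z \<otimes> (\<Oplus>u\<in>U. f u z \<otimes> L u x y)))"
    proof (intro finsum_cong')
      fix z assume z: "z \<in> A"
      show "h z \<otimes> (if x = y \<and> y = z then \<one> else \<zero>) =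
          h z \<otimes> (\<Oplus>u\<in>U. G u y z \<otimes> f u x) \<oplus>
          (h z \<otimes> (\<Oplus>u\<in>U. H u x z \<otimes> f u y) \<oplus> h z \<otimes> (\<Oplus>u\<in>U. f u z \<otimes> L u x y))"
        unfolding T[OF x y(1) z] L_comm[OF x y(1) z] using hc[OF z] c1[OF z] c2[OF z] c3[OF z] by (simp add: r_distr)
    qed (use hc c1 c2 c3 in auto)
    also have "\<dots> = (\<Oplus>z\<in>A. h z \<otimes> (\<Oplus>u\<in>U. G u y z \<otimes> f u x)) \<oplus>
        ((\<Oplus>z\<in>A. h z \<otimes> (\<Oplus>u\<in>U. H u x z \<otimes> f u y)) \<oplus> (\<Oplus>z\<in>A. h z \<otimes> (\<Oplus>u\<in>U. f u z \<otimes> L u x y)))"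
      using hc c1 c2 c3 by (simp add: finsum_addf Pi_iff)
    also have "(\<Oplus>z\<in>A. h z \<otimes> (\<Oplus>u\<in>U. f u z \<otimes> L u x y)) = \<zero>"
      using A U h f L x y by (intro finsum_pairing_zero) auto
    also have "(\<Oplus>z\<in>A. h z \<otimes> (\<Oplus>u\<in>U. G u y z \<otimes> f u x)) = (\<Oplus>u\<in>U. G' u y \<otimes> f u x)"
      unfolding G'_def using A U h f G x y by (intro finsum_pairing_swap) auto
    also have "\<dots> = (\<Oplus>u\<in>U. f u x \<otimes> G' u y)"
      using f x y G'c by (intro finsum_cong') (auto simp: m_comm)
    also have "(\<Oplus>z\<in>A. h z \<otimes> (\<Oplus>u\<in>U. H u x z \<otimes> f u y)) = (\<Oplus>u\<in>U. H' u x \<otimes> f u y)"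
      unfolding H'_def using A U h f H x y by (intro finsum_pairing_swap) auto
    finally show ?thesis
      using 1 f x y H'c by (simp add: r_zero finsum_closed Pi_iff)
  qed
  have c1: "(\<Oplus>u\<in>U. f u x \<otimes> G' u y) \<in> carrier R" if "x \<in> A" for x
    using that f G'c y by (intro finsum_closed) auto
  have c2: "(\<Oplus>u\<in>U. H' u x \<otimes> f u y) \<in> carrier R" if "x \<in> A" for x
    using that f H'c y by (intro finsum_closed) auto
  have "(\<Oplus>x\<in>S. g x \<otimes> (if x = y then h y else \<zero>)) = (\<Oplus>x\<in>S. if y = x then g x \<otimes> h y else \<zero>)"
    using gc hc y by (intro finsum_cong') auto
  also have "\<dots> = g y \<otimes> h y"
    using S gc hc y g(2) by (intro add.finprod_singleton) auto
  finally have 1: "(\<Oplus>x\<in>S. g x \<otimes> (if x = y then h y else \<zero>)) = g y \<otimes> h y" .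
  have "(\<Oplus>x\<in>S. g x \<otimes> (if x = y then h y else \<zero>)) =
      (\<Oplus>x\<in>S. g x \<otimes> (\<Oplus>u\<in>U. f u x \<otimes> G' u y) \<oplus> g x \<otimes> (\<Oplus>u\<in>U. H' u x \<otimes> f u y))"
  proof (intro finsum_cong')
    fix x assume x: "x \<in> S"
    then have "x \<in> A" using S by auto
    then show "g x \<otimes> (if x = y then h y else \<zero>) =
        g x \<otimes> (\<Oplus>u\<in>U. f u x \<otimes> G' u y) \<oplus> g x \<otimes> (\<Oplus>u\<in>U. H' u x \<otimes> f u y)"
      using gc[OF x] c1 c2 by (simp only: contract[symmetric] r_distr)
  qed (use S gc c1 c2 in auto)
  also have "\<dots> = (\<Oplus>x\<in>S. g x \<otimes> (\<Oplus>u\<in>U. f u x \<otimes> G' u y)) \<oplus> (\<Oplus>x\<in>S. g x \<otimes> (\<Oplus>u\<in>U. H' u x \<otimes> f u y))"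
    using S gc c1 c2 by (intro finsum_addf) auto
  also have "(\<Oplus>x\<in>S. g x \<otimes> (\<Oplus>u\<in>U. f u x \<otimes> G' u y)) = \<zero>"
    using S U g(1) f G'c y gf by (intro finsum_pairing_zero) auto
  also have "(\<Oplus>x\<in>S. g x \<otimes> (\<Oplus>u\<in>U. H' u x \<otimes> f u y)) = \<zero>"
    using S U g(1) f H'c y gH by (intro finsum_pairing_zero) auto
  finally have "g y \<otimes> h y = \<zero>" using 1 by simp
  then show False using g(2,3) gc y hc integral by blast
qed

section \<open>Slicing a product of one-coordinate polynomials\<close>

text \<open>
  By Lagrange's theorem for the additive group, \<open>q\<close> times \<open>1\<close> vanishes; if \<open>2\<close> vanished as well, so
  would \<open>1\<close>.
\<close>

lemma odd_card_two_nonzero: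
  assumes "odd (card (carrier R))"
  shows "\<one> \<oplus> \<one> \<noteq> \<zero>"
proof
  assume two: "\<one> \<oplus> \<one> = \<zero>"
  have even: "[(2 * k)] \<cdot> \<one> = \<zero>" for k :: nat
  proof (induction k)
    case (Suc k)
    have "[(2 * Suc k)] \<cdot> \<one> = [(2 * k)] \<cdot> \<one> \<oplus> \<one> \<oplus> \<one>" by simp
    then show ?case using Suc two by (simp add: a_assoc)
  qed simp
  obtain k where k: "card (carrier R) = Suc (2 * k)" using assms by (auto elim!: oddE)
  have "[(card (carrier R))] \<cdot> \<one> = \<zero>"
    using a_comm_group comm_group.power_order_eq_one[of "add_monoid R" \<one>] finite_carrier
    by (simp add: add_pow_def)
  then show False using even[of k] by (simp add: k)
qed

lemma indicator_zero:
  assumes "a \<in> carrier R"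
  shows "\<one> \<ominus> a [^] (card (carrier R) - 1) = (if a = \<zero> then \<one> else \<zero>)"
proof (cases "a = \<zero>")
  case True
  have "card (carrier R) - 1 \<noteq> 0" using card_carrier_ge_2 by simp
  then show ?thesis using True by (simp add: nat_pow_zero a_minus_def)
next
  case False
  then have "a \<in> Units R" using assms by (simp add: field_Units)
  moreover have "card (Units R) = card (carrier R) - 1"
    using finite_carrier by (simp add: field_Units card_Diff_singleton)
  moreover have "finite (Units R)" using finite_carrier by (simp add: field_Units)
  ultimately have "a [^] (card (carrier R) - 1) = \<one>" using units_power_order_eq_one by metis
  then show ?thesis using False by (simp add: a_minus_def r_neg)
qed

lemma finprod_indicator:
  "(\<Otimes>i\<in>{..<n::nat}. if P i then \<one> else \<zero>) = (if \<forall>i<n. P i then \<one> else \<zero>)"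
  by (induction n) (auto simp: lessThan_Suc less_Suc_eq)

definition monom_val :: "nat \<Rightarrow> (nat \<Rightarrow> nat) \<Rightarrow> (nat \<Rightarrow> 'a) \<Rightarrow> 'a" where
  "monom_val n u x = (\<Otimes>i\<in>{..<n}. x i [^] u i)"

lemma monom_val_closed [simp]:
  assumes "x \<in> carrier (AG R n)"
  shows "monom_val n u x \<in> carrier R"
  unfolding monom_val_def using AG_coord[OF assms] by (intro finprod_closed) auto

lemma monom_val_zero: "monom_val n (\<lambda>_. 0) x = \<one>"
  unfolding monom_val_def by simp

lemma monom_val_Suc:
  assumes x: "x \<in> carrier (AG R n)" and i: "i < n"
  shows "x i \<otimes> monom_val n u x = monom_val n (u(i := Suc (u i))) x"
proof -
  have xc: "x j \<in> carrier R" if "j < n" for j using AG_coord[OF x that] .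
  have set: "{..<n} = insert i ({..<n} - {i})" using i by auto
  have split: "monom_val n v x = x i [^] v i \<otimes> (\<Otimes>j\<in>{..<n} - {i}. x j [^] v j)" for v
    unfolding monom_val_def by (subst set, intro finprod_insert) (use xc i in auto)
  have "(\<Otimes>j\<in>{..<n} - {i}. x j [^] (u(i := Suc (u i))) j) = (\<Otimes>j\<in>{..<n} - {i}. x j [^] u j)"
    using xc by (intro finprod_cong') auto
  moreover have "(\<Otimes>j\<in>{..<n} - {i}. x j [^] u j) \<in> carrier R"
    using xc by (intro finprod_closed) auto
  ultimately show ?thesis using xc[OF i] unfolding split by (simp add: m_assoc m_comm m_lcomm)
qed

lemma monom_val_restrict:
  assumes "x \<in> carrier (AG R n)"
  shows "monom_val n (restrict u {..<n}) x = monom_val n u x"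
  unfolding monom_val_def using AG_coord[OF assms] by (intro finprod_cong') auto

text \<open>
  Functions of three points that agree with a polynomial whose monomials have exponents of \<open>x\<^sub>i\<close>, \<open>y\<^sub>i\<close> and
  \<open>z\<^sub>i\<close> adding up to at most \<open>D i\<close>, for each coordinate \<open>i\<close> separately. The coordinatewise budget bounds
  the individual exponents by \<open>q - 1\<close> and the total degree by \<open>n(q-1)\<close> at the same time. Only the values are
  recorded, so the product need not be multiplied out.
\<close>

inductive tri_poly :: "nat \<Rightarrow> (nat \<Rightarrow> nat) \<Rightarrow>
    ((nat \<Rightarrow> 'a) \<Rightarrow> (nat \<Rightarrow> 'a) \<Rightarrow> (nat \<Rightarrow> 'a) \<Rightarrow> 'a) \<Rightarrow> bool"
  for n D where
  monomial: "c \<in> carrier R \<Longrightarrow> (\<And>i. i < n \<Longrightarrow> u i + v i + w i \<le> D i) \<Longrightarrow>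
    (\<And>x y z. x \<in> carrier (AG R n) \<Longrightarrow> y \<in> carrier (AG R n) \<Longrightarrow> z \<in> carrier (AG R n) \<Longrightarrow>
      T x y z = c \<otimes> (monom_val n u x \<otimes> (monom_val n v y \<otimes> monom_val n w z))) \<Longrightarrow> tri_poly n D T"
| add: "tri_poly n D S \<Longrightarrow> tri_poly n D T \<Longrightarrow>
    (\<And>x y z. x \<in> carrier (AG R n) \<Longrightarrow> y \<in> carrier (AG R n) \<Longrightarrow> z \<in> carrier (AG R n) \<Longrightarrow>
      Q x y z = S x y z \<oplus> T x y z) \<Longrightarrow> tri_poly n D Q"

lemma tri_poly_closed:
  assumes "tri_poly n D T" "x \<in> carrier (AG R n)" "y \<in> carrier (AG R n)" "z \<in> carrier (AG R n)"
  shows "T x y z \<in> carrier R"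
  using assms by induction auto

lemma tri_poly_cong:
  assumes "tri_poly n D T"
    and "\<And>x y z. x \<in> carrier (AG R n) \<Longrightarrow> y \<in> carrier (AG R n) \<Longrightarrow> z \<in> carrier (AG R n) \<Longrightarrow> Q x y z = T x y z"
  shows "tri_poly n D Q"
  using assms(1)
proof (cases rule: tri_poly.cases)
  case (monomial c u v w)
  show ?thesis
    by (rule tri_poly.monomial[OF monomial(1,2)]) (simp_all add: assms(2) monomial(3))
next
  case (add S T')
  show ?thesis
    by (rule tri_poly.add[OF add(1,2)]) (simp add: assms(2) add(3))
qed

lemma tri_poly_mono:
  assumes "tri_poly n D T" "\<And>i. i < n \<Longrightarrow> D i \<le> D' i"
  shows "tri_poly n D' T"
  using assms(1)
proof induction
  case (monomial c u v w T)
  have "\<And>i. i < n \<Longrightarrow> u i + v i + w i \<le> D' i"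
    using monomial(2) assms(2) order_trans by blast
  then show ?case by (rule tri_poly.monomial[OF monomial(1)]) (simp_all add: monomial(3))
next
  case (add S T Q)
  show ?case by (rule tri_poly.add[OF add.IH]) (rule add.hyps(3))
qed

lemma tri_poly_smult:
  assumes "tri_poly n D T" "a \<in> carrier R"
  shows "tri_poly n D (\<lambda>x y z. a \<otimes> T x y z)"
  using assms(1)
proof induction
  case (monomial c u v w T)
  show ?case
    by (rule tri_poly.monomial[OF m_closed[OF assms(2) monomial(1)] monomial(2)])
      (simp_all add: m_assoc monomial(1,3) assms(2))
next
  case (add S T Q)
  show ?case
    by (rule tri_poly.add[OF add.IH])
      (use add.hyps(3) assms(2) tri_poly_closed[OF add.hyps(1)] tri_poly_closed[OF add.hyps(2)] in
        \<open>simp add: r_distr\<close>)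
qed

lemma tri_poly_mult_first:
  assumes "tri_poly n D T" "i < n"
  shows "tri_poly n (D(i := Suc (D i))) (\<lambda>x y z. x i \<otimes> T x y z)"
  using assms(1)
proof induction
  case (monomial c u v w T)
  show ?case
  proof (rule tri_poly.monomial[of c n "u(i := Suc (u i))" v w])
    fix x y z assume xyz: "x \<in> carrier (AG R n)" "y \<in> carrier (AG R n)" "z \<in> carrier (AG R n)"
    show "x i \<otimes> T x y z = c \<otimes> (monom_val n (u(i := Suc (u i))) x \<otimes> (monom_val n v y \<otimes> monom_val n w z))"
      unfolding monom_val_Suc[OF xyz(1) assms(2), symmetric] monomial(3)[OF xyz]
      using monomial(1) xyz AG_coord[OF xyz(1) assms(2)] by (simp add: m_ac)
  qed (use monomial in auto)
next
  case (add S T Q)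
  show ?case
    by (rule tri_poly.add[OF add.IH])
      (use add.hyps(3) assms(2) tri_poly_closed[OF add.hyps(1)] tri_poly_closed[OF add.hyps(2)] in
        \<open>simp add: r_distr AG_coord\<close>)
qed

lemma tri_poly_mult_second:
  assumes "tri_poly n D T" "i < n"
  shows "tri_poly n (D(i := Suc (D i))) (\<lambda>x y z. y i \<otimes> T x y z)"
  using assms(1)
proof induction
  case (monomial c u v w T)
  show ?case
  proof (rule tri_poly.monomial[of c n u "v(i := Suc (v i))" w])
    fix x y z assume xyz: "x \<in> carrier (AG R n)" "y \<in> carrier (AG R n)" "z \<in> carrier (AG R n)"
    show "y i \<otimes> T x y z = c \<otimes> (monom_val n u x \<otimes> (monom_val n (v(i := Suc (v i))) y \<otimes> monom_val n w z))"
      unfolding monom_val_Suc[OF xyz(2) assms(2), symmetric] monomial(3)[OF xyz]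
      using monomial(1) xyz AG_coord[OF xyz(2) assms(2)] by (simp add: m_ac)
  qed (use monomial in auto)
next
  case (add S T Q)
  show ?case
    by (rule tri_poly.add[OF add.IH])
      (use add.hyps(3) assms(2) tri_poly_closed[OF add.hyps(1)] tri_poly_closed[OF add.hyps(2)] in
        \<open>simp add: r_distr AG_coord\<close>)
qed

lemma tri_poly_mult_third:
  assumes "tri_poly n D T" "i < n"
  shows "tri_poly n (D(i := Suc (D i))) (\<lambda>x y z. z i \<otimes> T x y z)"
  using assms(1)
proof induction
  case (monomial c u v w T)
  show ?case
  proof (rule tri_poly.monomial[of c n u v "w(i := Suc (w i))"])
    fix x y z assume xyz: "x \<in> carrier (AG R n)" "y \<in> carrier (AG R n)" "z \<in> carrier (AG R n)"
    show "z i \<otimes> T x y z = c \<otimes> (monom_val n u x \<otimes> (monom_val n v y \<otimes> monom_val n (w(i := Suc (w i))) z))"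
      unfolding monom_val_Suc[OF xyz(3) assms(2), symmetric] monomial(3)[OF xyz]
      using monomial(1) xyz AG_coord[OF xyz(3) assms(2)] by (simp add: m_ac)
  qed (use monomial in auto)
next
  case (add S T Q)
  show ?case
    by (rule tri_poly.add[OF add.IH])
      (use add.hyps(3) assms(2) tri_poly_closed[OF add.hyps(1)] tri_poly_closed[OF add.hyps(2)] in
        \<open>simp add: r_distr AG_coord\<close>)
qed

definition lin_form :: "'a \<Rightarrow> (nat \<Rightarrow> 'a) \<Rightarrow> (nat \<Rightarrow> 'a) \<Rightarrow> (nat \<Rightarrow> 'a) \<Rightarrow> nat \<Rightarrow> 'a" where
  "lin_form a x y z i = x i \<oplus> (y i \<oplus> a \<otimes> z i)"

lemma lin_form_closed:
  assumes "a \<in> carrier R" "x \<in> carrier (AG R n)" "y \<in> carrier (AG R n)" "z \<in> carrier (AG R n)" "i < n"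
  shows "lin_form a x y z i \<in> carrier R"
  using assms by (simp add: lin_form_def AG_coord)

lemma tri_poly_mult_lin_form:
  assumes T: "tri_poly n D T" and a: "a \<in> carrier R" and i: "i < n"
  shows "tri_poly n (D(i := Suc (D i))) (\<lambda>x y z. lin_form a x y z i \<otimes> T x y z)"
proof -
  have "tri_poly n (D(i := Suc (D i))) (\<lambda>x y z. y i \<otimes> T x y z \<oplus> a \<otimes> (z i \<otimes> T x y z))"
    by (rule tri_poly.add[OF tri_poly_mult_second[OF T i] tri_poly_smult[OF tri_poly_mult_third[OF T i] a]]) simp
  then show ?thesis
  proof (rule tri_poly.add[OF tri_poly_mult_first[OF T i]])
    fix x y z assume xyz: "x \<in> carrier (AG R n)" "y \<in> carrier (AG R n)" "z \<in> carrier (AG R n)"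
    show "lin_form a x y z i \<otimes> T x y z = x i \<otimes> T x y z \<oplus> (y i \<otimes> T x y z \<oplus> a \<otimes> (z i \<otimes> T x y z))"
      using a tri_poly_closed[OF T xyz] xyz[THEN AG_coord, OF i] by (simp add: lin_form_def l_distr m_assoc)
  qed
qed

lemma tri_poly_mult_lin_form_pow:
  assumes T: "tri_poly n D T" and a: "a \<in> carrier R" and i: "i < n"
  shows "tri_poly n (D(i := D i + k)) (\<lambda>x y z. lin_form a x y z i [^] k \<otimes> T x y z)"
proof (induction k)
  case 0
  have "tri_poly n (D(i := D i + 0)) T" by (rule tri_poly_mono[OF T]) simp
  then show ?case by (rule tri_poly_cong) (simp add: tri_poly_closed[OF T])
next
  case (Suc k)
  have "tri_poly n (D(i := Suc (D i + k))) (\<lambda>x y z. lin_form a x y z i \<otimes> (lin_form a x y z i [^] k \<otimes> T x y z))"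
    using tri_poly_mult_lin_form[OF Suc a i] by (simp only: fun_upd_same fun_upd_upd)
  then have "tri_poly n (D(i := Suc (D i + k))) (\<lambda>x y z. lin_form a x y z i [^] Suc k \<otimes> T x y z)"
  proof (rule tri_poly_cong)
    fix x y z assume xyz: "x \<in> carrier (AG R n)" "y \<in> carrier (AG R n)" "z \<in> carrier (AG R n)"
    show "lin_form a x y z i [^] Suc k \<otimes> T x y z = lin_form a x y z i \<otimes> (lin_form a x y z i [^] k \<otimes> T x y z)"
      using tri_poly_closed[OF T xyz] lin_form_closed[OF a xyz i] by (simp add: m_ac)
  qed
  then show ?case by (simp only: add_Suc_right)
qed

lemma tri_poly_mult_one_minus:
  assumes T: "tri_poly n D T" and a: "a \<in> carrier R" and i: "i < n"
  shows "tri_poly n (D(i := D i + k)) (\<lambda>x y z. (\<one> \<ominus> lin_form a x y z i [^] k) \<otimes> T x y z)"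
proof (rule tri_poly.add)
  show "tri_poly n (D(i := D i + k)) T" by (rule tri_poly_mono[OF T]) simp
  show "tri_poly n (D(i := D i + k)) (\<lambda>x y z. \<ominus> \<one> \<otimes> (lin_form a x y z i [^] k \<otimes> T x y z))"
    by (intro tri_poly_smult tri_poly_mult_lin_form_pow T a i) simp
  fix x y z assume xyz: "x \<in> carrier (AG R n)" "y \<in> carrier (AG R n)" "z \<in> carrier (AG R n)"
  show "(\<one> \<ominus> lin_form a x y z i [^] k) \<otimes> T x y z =
      T x y z \<oplus> \<ominus> \<one> \<otimes> (lin_form a x y z i [^] k \<otimes> T x y z)"
    using tri_poly_closed[OF T xyz] lin_form_closed[OF a xyz i] by (simp add: a_minus_def l_distr l_minus)
qed

text \<open>
  Each factor spends \<open>k\<close> units of the budget of its own coordinate.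
\<close>

lemma tri_poly_prod:
  assumes a: "a \<in> carrier R" and j: "j \<le> n"
  shows "tri_poly n (\<lambda>i. if i < j then k else 0) (\<lambda>x y z. \<Otimes>i\<in>{..<j}. \<one> \<ominus> lin_form a x y z i [^] k)"
  using j
proof (induction j)
  case 0
  show ?case
    by (rule tri_poly.monomial[of \<one> n "\<lambda>_. 0" "\<lambda>_. 0" "\<lambda>_. 0"]) (auto simp: monom_val_zero)
next
  case (Suc j)
  have D: "(\<lambda>i. if i < j then k else 0)(j := (if j < j then k else 0) + k) = (\<lambda>i. if i < Suc j then k else 0)"
    by (auto simp: fun_eq_iff)
  have "tri_poly n (\<lambda>i. if i < Suc j then k else 0)
    (\<lambda>x y z. (\<one> \<ominus> lin_form a x y z j [^] k) \<otimes> (\<Otimes>i\<in>{..<j}. \<one> \<ominus> lin_form a x y z i [^] k))"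
    using tri_poly_mult_one_minus[OF Suc.IH a, of j k] Suc.prems unfolding D by simp
  then show ?case
  proof (rule tri_poly_cong)
    fix x y z assume xyz: "x \<in> carrier (AG R n)" "y \<in> carrier (AG R n)" "z \<in> carrier (AG R n)"
    have "lin_form a x y z i \<in> carrier R" if "i < Suc j" for i
      using lin_form_closed[OF a xyz, of i] that Suc.prems by simp
    then show "(\<Otimes>i\<in>{..<Suc j}. \<one> \<ominus> lin_form a x y z i [^] k) =
        (\<one> \<ominus> lin_form a x y z j [^] k) \<otimes> (\<Otimes>i\<in>{..<j}. \<one> \<ominus> lin_form a x y z i [^] k)"
      unfolding lessThan_Suc by (intro finprod_insert) auto
  qed
qed

lemma finsum_zero_mult:
  assumes "f \<in> U \<rightarrow> carrier R"
  shows "(\<Oplus>u\<in>U. \<zero> \<otimes> f u) = \<zero>"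
proof -
  have "(\<Oplus>u\<in>U. \<zero> \<otimes> f u) = (\<Oplus>u\<in>U. \<zero>)" using assms by (intro finsum_cong') (auto simp: Pi_iff)
  then show ?thesis by simp
qed

lemma finsum_single_mult:
  assumes "finite U" "u0 \<in> U" "g \<in> carrier R" "f \<in> U \<rightarrow> carrier R"
  shows "(\<Oplus>u\<in>U. (if u = u0 then g else \<zero>) \<otimes> f u) = g \<otimes> f u0"
proof -
  have "(\<Oplus>u\<in>U. (if u = u0 then g else \<zero>) \<otimes> f u) = (\<Oplus>u\<in>U. if u0 = u then g \<otimes> f u else \<zero>)"
    using assms(3,4) by (intro finsum_cong') (auto simp: Pi_iff)
  also have "\<dots> = g \<otimes> f u0"
    using assms by (intro add.finprod_singleton) auto
  finally show ?thesis .
qed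

text \<open>
  The shape of a tensor to which \<open>slice_rank_diagonal\<close> applies, with the monomials with
  exponents in \<open>U\<close> in the role of the functions \<open>f u\<close>.
\<close>

definition slice_decomp where
  "slice_decomp n U G H L T \<longleftrightarrow>
    (\<forall>u\<in>U. \<forall>x\<in>carrier (AG R n). \<forall>y\<in>carrier (AG R n).
      G u x y \<in> carrier R \<and> H u x y \<in> carrier R \<and> L u x y \<in> carrier R) \<and>
    (\<forall>x\<in>carrier (AG R n). \<forall>y\<in>carrier (AG R n). \<forall>z\<in>carrier (AG R n).
      T x y z = (\<Oplus>u\<in>U. G u y z \<otimes> monom_val n u x) \<oplus>
        ((\<Oplus>u\<in>U. H u x z \<otimes> monom_val n u y) \<oplus> (\<Oplus>u\<in>U. L u x y \<otimes> monom_val n u z)))"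

lemma slice_decompI:
  assumes "\<And>u x y. u \<in> U \<Longrightarrow> x \<in> carrier (AG R n) \<Longrightarrow> y \<in> carrier (AG R n) \<Longrightarrow>
      G u x y \<in> carrier R \<and> H u x y \<in> carrier R \<and> L u x y \<in> carrier R"
    "\<And>x y z. x \<in> carrier (AG R n) \<Longrightarrow> y \<in> carrier (AG R n) \<Longrightarrow> z \<in> carrier (AG R n) \<Longrightarrow>
      T x y z = (\<Oplus>u\<in>U. G u y z \<otimes> monom_val n u x) \<oplus>
        ((\<Oplus>u\<in>U. H u x z \<otimes> monom_val n u y) \<oplus> (\<Oplus>u\<in>U. L u x y \<otimes> monom_val n u z))"
  shows "slice_decomp n U G H L T"
  unfolding slice_decomp_def by (intro conjI ballI assms(2)) (simp_all add: assms(1))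

lemma slice_decompD:
  assumes "slice_decomp n U G H L T"
  shows "u \<in> U \<Longrightarrow> x \<in> carrier (AG R n) \<Longrightarrow> y \<in> carrier (AG R n) \<Longrightarrow>
      G u x y \<in> carrier R \<and> H u x y \<in> carrier R \<and> L u x y \<in> carrier R"
    and "x \<in> carrier (AG R n) \<Longrightarrow> y \<in> carrier (AG R n) \<Longrightarrow> z \<in> carrier (AG R n) \<Longrightarrow>
      T x y z = (\<Oplus>u\<in>U. G u y z \<otimes> monom_val n u x) \<oplus>
        ((\<Oplus>u\<in>U. H u x z \<otimes> monom_val n u y) \<oplus> (\<Oplus>u\<in>U. L u x y \<otimes> monom_val n u z))"
  using assms by (simp_all add: slice_decomp_def)

lemma sliced_monomial:
  assumes U: "finite U" and c: "c \<in> carrier R"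
    and uvw: "restrict u {..<n} \<in> U \<or> restrict v {..<n} \<in> U \<or> restrict w {..<n} \<in> U"
    and T: "\<And>x y z. x \<in> carrier (AG R n) \<Longrightarrow> y \<in> carrier (AG R n) \<Longrightarrow> z \<in> carrier (AG R n) \<Longrightarrow>
      T x y z = c \<otimes> (monom_val n u x \<otimes> (monom_val n v y \<otimes> monom_val n w z))"
  shows "\<exists>G H L. slice_decomp n U G H L T"
proof -
  have z: "(\<Oplus>u\<in>U. \<zero> \<otimes> monom_val n u x) = \<zero>" if "x \<in> carrier (AG R n)" for x
    using that by (intro finsum_zero_mult) auto
  have s: "(\<Oplus>u\<in>U. (if u = restrict u0 {..<n} then g else \<zero>) \<otimes> monom_val n u x) = g \<otimes> monom_val n u0 x"
    if "restrict u0 {..<n} \<in> U" "g \<in> carrier R" "x \<in> carrier (AG R n)" for u0 g x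
    using finsum_single_mult[OF U that(1,2), of "\<lambda>u. monom_val n u x"] that(3) by (simp add: monom_val_restrict)
  from uvw consider "restrict u {..<n} \<in> U" | "restrict v {..<n} \<in> U" | "restrict w {..<n} \<in> U" by blast
  then show ?thesis
  proof cases
    case 1
    have eq: "T x y z = (c \<otimes> (monom_val n v y \<otimes> monom_val n w z)) \<otimes> monom_val n u x"
      if "x \<in> carrier (AG R n)" "y \<in> carrier (AG R n)" "z \<in> carrier (AG R n)" for x y z
      using that c by (simp add: T m_ac)
    show ?thesis
      by (intro exI, rule slice_decompI[where G = "\<lambda>u' y z. if u' = restrict u {..<n} then c \<otimes> (monom_val n v y \<otimes> monom_val n w z) else \<zero>"
            and H = "\<lambda>_ _ _. \<zero>" and L = "\<lambda>_ _ _. \<zero>"])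
        (simp_all add: c eq z s[OF 1])
  next
    case 2
    have eq: "T x y z = (c \<otimes> (monom_val n u x \<otimes> monom_val n w z)) \<otimes> monom_val n v y"
      if "x \<in> carrier (AG R n)" "y \<in> carrier (AG R n)" "z \<in> carrier (AG R n)" for x y z
      using that c by (simp add: T m_ac)
    show ?thesis
      by (intro exI, rule slice_decompI[where H = "\<lambda>u' x z. if u' = restrict v {..<n} then c \<otimes> (monom_val n u x \<otimes> monom_val n w z) else \<zero>"
            and G = "\<lambda>_ _ _. \<zero>" and L = "\<lambda>_ _ _. \<zero>"])
        (simp_all add: c eq z s[OF 2])
  next
    case 3
    have eq: "T x y z = (c \<otimes> (monom_val n u x \<otimes> monom_val n v y)) \<otimes> monom_val n w z"
      if "x \<in> carrier (AG R n)" "y \<in> carrier (AG R n)" "z \<in> carrier (AG R n)" for x y z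
      using that c by (simp add: T m_ac)
    show ?thesis
      by (intro exI, rule slice_decompI[where L = "\<lambda>u' x y. if u' = restrict w {..<n} then c \<otimes> (monom_val n u x \<otimes> monom_val n v y) else \<zero>"
            and G = "\<lambda>_ _ _. \<zero>" and H = "\<lambda>_ _ _. \<zero>"])
        (simp_all add: c eq z s[OF 3])
  qed
qed

lemma sliced_add:
  assumes U: "finite U" and S: "\<exists>G H L. slice_decomp n U G H L S" and T: "\<exists>G H L. slice_decomp n U G H L T"
    and Q: "\<And>x y z. x \<in> carrier (AG R n) \<Longrightarrow> y \<in> carrier (AG R n) \<Longrightarrow> z \<in> carrier (AG R n) \<Longrightarrow>
      Q x y z = S x y z \<oplus> T x y z"
  shows "\<exists>G H L. slice_decomp n U G H L Q"
proof -
  let ?V = "carrier (AG R n)"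
  from S obtain G H L where SD: "slice_decomp n U G H L S" by blast
  from T obtain G' H' L' where TD: "slice_decomp n U G' H' L' T" by blast
  note c = slice_decompD(1)[OF SD] slice_decompD(1)[OF TD]
  have split: "(\<Oplus>u\<in>U. (g u \<oplus> g' u) \<otimes> monom_val n u x) =
      (\<Oplus>u\<in>U. g u \<otimes> monom_val n u x) \<oplus> (\<Oplus>u\<in>U. g' u \<otimes> monom_val n u x)"
    "(\<Oplus>u\<in>U. g u \<otimes> monom_val n u x) \<in> carrier R" "(\<Oplus>u\<in>U. g' u \<otimes> monom_val n u x) \<in> carrier R"
    if "\<And>u. u \<in> U \<Longrightarrow> g u \<in> carrier R" "\<And>u. u \<in> U \<Longrightarrow> g' u \<in> carrier R" "x \<in> ?V" for g g' x
    using that by (auto intro!: finsum_pairing_add finsum_closed)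
  show ?thesis
  proof (intro exI, rule slice_decompI[where G = "\<lambda>u x y. G u x y \<oplus> G' u x y" and H = "\<lambda>u x y. H u x y \<oplus> H' u x y"
        and L = "\<lambda>u x y. L u x y \<oplus> L' u x y"])
    fix x y z assume x: "x \<in> ?V" and y: "y \<in> ?V" and z: "z \<in> ?V"
    note G = split[of "\<lambda>u. G u y z" "\<lambda>u. G' u y z", OF _ _ x]
    note H = split[of "\<lambda>u. H u x z" "\<lambda>u. H' u x z", OF _ _ y]
    note L = split[of "\<lambda>u. L u x y" "\<lambda>u. L' u x y", OF _ _ z]
    show "Q x y z = (\<Oplus>u\<in>U. (G u y z \<oplus> G' u y z) \<otimes> monom_val n u x) \<oplus>
        ((\<Oplus>u\<in>U. (H u x z \<oplus> H' u x z) \<otimes> monom_val n u y) \<oplus> (\<Oplus>u\<in>U. (L u x y \<oplus> L' u x y) \<otimes> monom_val n u z))"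
      unfolding Q[OF x y z] slice_decompD(2)[OF SD x y z] slice_decompD(2)[OF TD x y z]
      using G H L c x y z by (simp add: a_ac)
  qed (simp add: c)
qed

text \<open>
  The three parts of a monomial have total degree at most \<open>n(q-1)\<close>, so one of them has degree at most a
  third of it, and the monomial is a single slice in the corresponding variable.
\<close>

lemma tri_poly_sliced:
  assumes "tri_poly n D T" "\<And>i. i < n \<Longrightarrow> D i \<le> q - 1" "0 < q"
  shows "\<exists>G H L. slice_decomp n (low_exps n q) G H L T"
  using assms(1)
proof induction
  case (monomial c u v w T)
  have le: "u i + v i + w i \<le> q - 1" if "i < n" for i
    using monomial(2)[OF that] assms(2)[OF that] by linarith
  have "(\<Sum>i<n. u i) + (\<Sum>i<n. v i) + (\<Sum>i<n. w i) = (\<Sum>i<n. u i + v i + w i)"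
    by (simp add: sum.distrib)
  also have "\<dots> \<le> (\<Sum>i<n. q - 1)" using le by (intro sum_mono) auto
  finally have tot: "(\<Sum>i<n. u i) + (\<Sum>i<n. v i) + (\<Sum>i<n. w i) \<le> n * (q - 1)" by simp
  have low: "restrict u' {..<n} \<in> low_exps n q"
    if "3 * (\<Sum>i<n. u' i) \<le> n * (q - 1)" "\<And>i. i < n \<Longrightarrow> u' i \<le> q - 1" for u'
    using that assms(3) by (force simp: low_exps_def)
  have "3 * (\<Sum>i<n. u i) \<le> n * (q - 1) \<or> 3 * (\<Sum>i<n. v i) \<le> n * (q - 1) \<or> 3 * (\<Sum>i<n. w i) \<le> n * (q - 1)"
    using tot by linarith
  moreover have "u i \<le> q - 1" "v i \<le> q - 1" "w i \<le> q - 1" if "i < n" for i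
    using le[OF that] by linarith+
  ultimately have "restrict u {..<n} \<in> low_exps n q \<or> restrict v {..<n} \<in> low_exps n q \<or>
      restrict w {..<n} \<in> low_exps n q"
    using low by blast
  then show ?case by (rule sliced_monomial[OF finite_low_exps monomial(1)]) (rule monomial(3))
next
  case (add S T Q)
  show ?case by (rule sliced_add[OF finite_low_exps add.IH]) (rule add.hyps(3))
qed

text \<open>
  For three distinct points the equation \<open>x + y = 2z\<close> is an affine dependence with coefficients \<open>1, 1, -2\<close>. If
  two of the points coincide, it forces the third to coincide with them: \<open>2x = 2z\<close> by \<open>2 \<noteq> 0\<close>, and
  the two other cases by cancellation.
\<close>

lemma cap_three_term_eq:
  assumes odd: "odd (card (carrier R))" and n: "1 \<le> n" and A: "m_general 3 R n A"
    and xyz: "x \<in> A" "y \<in> A" "z \<in> A"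
  shows "(\<forall>i<n. lin_form (\<ominus> (\<one> \<oplus> \<one>)) x y z i = \<zero>) \<longleftrightarrow> x = y \<and> y = z"
proof -
  define a where "a = \<ominus> (\<one> \<oplus> \<one>)"
  have a: "a \<in> carrier R" by (simp add: a_def)
  have V: "v \<in> carrier (AG R n)" if "v \<in> A" for v using A that by (auto simp: m_general_def)
  have c: "x i \<in> carrier R" "y i \<in> carrier R" "z i \<in> carrier R" if "i < n" for i
    using V[THEN AG_coord, OF _ that] xyz by auto
  have dbl: "a \<otimes> r = \<ominus> (r \<oplus> r)" if "r \<in> carrier R" for r
    using that by (simp add: a_def l_minus l_distr)
  show ?thesis unfolding a_def[symmetric]
  proof (intro iffI)
    assume "x = y \<and> y = z"
    then show "\<forall>i<n. lin_form a x y z i = \<zero>"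
      using c by (simp add: lin_form_def dbl a_assoc[symmetric] r_neg)
  next
    assume "\<forall>i<n. lin_form a x y z i = \<zero>"
    then have eq: "x i \<oplus> y i = z i \<oplus> z i" if "i < n" for i
      
    proof -
      have "\<zero> = lin_form a x y z i" using \<open>\<forall>i<n. lin_form a x y z i = \<zero>\<close> that by simp
      also have "\<dots> = (x i \<oplus> y i) \<ominus> (z i \<oplus> z i)"
        using c[OF that] by (simp add: lin_form_def dbl a_minus_def a_assoc)
      finally show ?thesis using r_right_minus_eq[of "x i \<oplus> y i" "z i \<oplus> z i"] c[OF that] by simp
    qed
    have "x = z" if "x = y"
    proof (rule AG_eqI[OF V[OF xyz(1)] V[OF xyz(3)]])
      fix i assume i: "i < n"
      have "(\<one> \<oplus> \<one>) \<otimes> (x i \<ominus> z i) = (x i \<oplus> x i) \<ominus> (z i \<oplus> z i)"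
        using c[OF i] by (simp add: l_distr a_minus_def minus_add a_ac)
      also have "\<dots> = \<zero>" using eq[OF i] that c[OF i] by simp
      finally have "x i \<ominus> z i = \<zero>"
        using integral_iff[of "\<one> \<oplus> \<one>" "x i \<ominus> z i"] odd_card_two_nonzero[OF odd] c[OF i] by simp
      then show "x i = z i" using c[OF i] by simp
    qed
    moreover have "y = x" if "x = z"
    proof (rule AG_eqI[OF V[OF xyz(2)] V[OF xyz(1)]])
      show "y i = x i" if "i < n" for i using eq[OF that] c[OF that] \<open>x = z\<close> a_comm[of "z i" "y i"] by simp
    qed
    moreover have "x = y" if "y = z"
    proof (rule AG_eqI[OF V[OF xyz(1)] V[OF xyz(2)]])
      show "x i = y i" if "i < n" for i using eq[OF that] c[OF that] \<open>y = z\<close> by simp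
    qed
    moreover have "\<not> (x \<noteq> y \<and> y \<noteq> z \<and> x \<noteq> z)"
    proof
      assume d: "x \<noteq> y \<and> y \<noteq> z \<and> x \<noteq> z"
      define b where "b v = (if v = z then a else \<one>)" for v
      have "b x = \<zero>"
      proof (rule m_general_affinely_independent[OF _ _ A, of "{x, y, z}" b x])
        show "{x, y, z} \<subseteq> A" using xyz by simp
        show "card {x, y, z} \<le> 3" by (simp add: card_insert_if)
        show "b \<in> {x, y, z} \<rightarrow> carrier R" using a by (simp add: b_def)
        show "(\<Oplus>v\<in>{x, y, z}. b v) = \<zero>"
          using d a by (simp add: b_def) (simp add: a_def a_assoc[symmetric] r_neg)
        show "(\<Oplus>v\<in>{x, y, z}. b v \<otimes> v i) = \<zero>" if "i < n" for i
          using d a c[OF that] \<open>\<forall>i<n. lin_form a x y z i = \<zero>\<close> that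
          by (simp add: b_def lin_form_def)
      qed (use n in auto)
      then show False using d by (simp add: b_def)
    qed
    ultimately show "x = y \<and> y = z" by blast
  qed
qed

text \<open>
  By Fermat's little theorem \<open>1 - a\<^sup>q\<^sup>-\<^sup>1\<close> is the indicator of \<open>a = 0\<close>, so \<open>T\<close> below is the indicator of
  \<open>x + y = 2z\<close>, that is, of the diagonal of the cap.
\<close>

lemma cap_card_le:
  assumes odd: "odd (card (carrier R))" and n: "1 \<le> n" and A: "m_general 3 R n A"
  shows "card A \<le> 3 * card (low_exps n (card (carrier R)))"
proof -
  define q where "q = card (carrier R)"
  define a where "a = \<ominus> (\<one> \<oplus> \<one>)"
  define T where "T x y z = (\<Otimes>i\<in>{..<n}. \<one> \<ominus> lin_form a x y z i [^] (q - 1))" for x y z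
  have AV: "A \<subseteq> carrier (AG R n)" "finite A"
    using A by (auto simp: m_general_def intro: card_ge_0_finite)
  have "tri_poly n (\<lambda>i. if i < n then q - 1 else 0) T"
    unfolding T_def by (intro tri_poly_prod) (auto simp: a_def)
  then have "\<exists>G H L. slice_decomp n (low_exps n q) G H L T"
    by (rule tri_poly_sliced) (use card_carrier_ge_2 in \<open>auto simp: q_def\<close>)
  then obtain G H L where D: "slice_decomp n (low_exps n q) G H L T" by blast
  have diag: "T x y z = (if x = y \<and> y = z then \<one> else \<zero>)" if xyz: "x \<in> A" "y \<in> A" "z \<in> A" for x y z
  proof -
    have V: "x \<in> carrier (AG R n)" "y \<in> carrier (AG R n)" "z \<in> carrier (AG R n)" using AV xyz by auto
    have "T x y z = (\<Otimes>i\<in>{..<n}. if lin_form a x y z i = \<zero> then \<one> else \<zero>)"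
      unfolding T_def q_def
    proof (rule finprod_cong'[OF refl])
      fix i assume "i \<in> {..<n}"
      then show "\<one> \<ominus> lin_form a x y z i [^] (card (carrier R) - 1) = (if lin_form a x y z i = \<zero> then \<one> else \<zero>)"
        by (intro indicator_zero lin_form_closed[OF _ V]) (auto simp: a_def)
    qed auto
    also have "\<dots> = (if \<forall>i<n. lin_form a x y z i = \<zero> then \<one> else \<zero>)" by (rule finprod_indicator)
    finally show ?thesis unfolding a_def cap_three_term_eq[OF odd n A xyz] .
  qed
  show ?thesis
    unfolding q_def[symmetric]
  proof (rule slice_rank_diagonal[OF AV(2) finite_low_exps, of n q "monom_val n" G H L])
    fix x y z assume xyz: "x \<in> A" "y \<in> A" "z \<in> A"
    show "(if x = y \<and> y = z then \<one> else \<zero>) =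
        (\<Oplus>u\<in>low_exps n q. G u y z \<otimes> monom_val n u x) \<oplus>
        ((\<Oplus>u\<in>low_exps n q. H u x z \<otimes> monom_val n u y) \<oplus> (\<Oplus>u\<in>low_exps n q. L u x y \<otimes> monom_val n u z))"
      unfolding diag[OF xyz, symmetric] by (rule slice_decompD(2)[OF D]) (use xyz AV in auto)
  qed (use slice_decompD(1)[OF D] AV in auto)
qed

end

section \<open>The bounds on general sets\<close>

text \<open>
  Even \<open>q\<close> occurs only together with even \<open>m\<close>. This gives odd \<open>q\<close> for caps, and \<open>q \<ge> 3\<close> whenever \<open>m\<close>
  is odd in the subset-sum bound.
\<close>

lemma m_general_card_le:
  fixes F :: "'a ring"
  assumes F: "field F" "finite (carrier F)" and m: "3 \<le> m" "m \<le> n + 2"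
    and parity: "odd (card (carrier F)) \<or> even m \<and> even (card (carrier F))"
    and A: "m_general m F n A" and t: "0 < t" "t < 1"
  shows "real (card A) \<le> real m * target_root m (card (carrier F)) t ^ n"
proof -
  interpret finite_field F
    using F by (simp add: finite_field_def finite_field_axioms_def)
  define q where "q = card (carrier F)"
  have q: "2 \<le> q" using card_carrier_ge_2 by (simp add: q_def)
  show ?thesis unfolding q_def[symmetric]
  proof (cases "m = 3")
    case True
    have "real (card A) \<le> real (3 * card (low_exps n q))"
      using cap_card_le[of n A] parity m A True by (simp add: q_def del: of_nat_mult)
    also have "\<dots> \<le> 3 * target_root 3 q t ^ n"
      using card_low_exps_le[OF t, of q n] q by simp
    finally show "real (card A) \<le> real m * target_root m q t ^ n" by (simp add: True)
  next
    case False
    have "real (card A) \<le> real (m div 2) * target_root m q t ^ n"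
    proof (rule le_of_choose_le)
      show "card A choose (m div 2) \<le> q ^ n" using choose_half_le[OF m A] by (simp add: q_def)
      have "3 \<le> q" if "odd m"
        using that parity q by (cases "q = 2") (auto simp: q_def)
      then show "real q \<le> target_root m q t ^ (m div 2)"
        using False m q by (intro target_root_power_ge t) auto
    qed (use m q t target_root_pos[of t q m] in auto)
    also have "\<dots> \<le> real m * target_root m q t ^ n"
      using target_root_pos[of t q m] t q by (intro mult_right_mono) auto
    finally show "real (card A) \<le> real m * target_root m q t ^ n" .
  qed
qed

lemma max_general_less:
  fixes F :: "'a ring"
  assumes F: "field F" "finite (carrier F)" and b: "0 < b"
    and le: "\<And>A. m_general m F n A \<Longrightarrow> real (card A) < b"
  shows "real (max_general m F n) < b"
proof -
  interpret finite_field F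
    using F by (simp add: finite_field_def finite_field_axioms_def)
  have "finite (carrier (AG F n))" unfolding AG_simps(1) by (intro finite_PiE finite_carrier) auto
  then have "finite {A. m_general m F n A}"
    by (rule finite_subset[rotated, OF finite_Pow_iff[THEN iffD2]]) (auto simp: m_general_def)
  then have "max_general m F n \<in> insert 0 (card ` {A. m_general m F n A})"
    unfolding max_general_def by (intro Max_in) auto
  then show ?thesis using b le by auto
qed

theorem theorem1p2:
  fixes m :: nat
  assumes "m \<ge> 3"
  shows "\<exists>\<alpha> C :: real. 0 < \<alpha> \<and> \<alpha> < 1 \<and>
    (\<forall>n q :: nat. n > 0 \<longrightarrow> m \<le> n + 2 \<longrightarrow> primepow q \<longrightarrow> odd q \<or> (even m \<and> even q) \<longrightarrow>
      (\<exists>t. is_arg_min (min_target m n q) (\<lambda>t. t \<in> {0<..<1}) t \<and>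
        (\<forall>F :: nat ring. field F \<longrightarrow> finite (carrier F) \<longrightarrow> card (carrier F) = q \<longrightarrow>
           real (max_general m F n) < 2 * real m + real m * min_target m n q t) \<and>
        2 * real m + real m * min_target m n q t
          \<le> 2 * real m + real m *
              (real m * exp (1 - \<alpha> / real m) / (real m ^ 2 - \<alpha> * real m + \<alpha>) * real q + C) ^ n))"
proof -
  define \<alpha> where "\<alpha> = exp (- real m)"
  have \<alpha>: "0 < \<alpha>" "\<alpha> < 1" using assms by (auto simp: \<alpha>_def)
  show ?thesis
  proof (rule exI[of _ \<alpha>], rule exI[of _ "exp 1"], intro conjI \<alpha> allI impI)
    fix n q :: nat
    assume n: "n > 0" "m \<le> n + 2" and q: "primepow q" and parity: "odd q \<or> (even m \<and> even q)"
    have q2: "2 \<le> q" using primepow_gt_Suc_0[OF q] by simp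
    obtain t where t: "0 < t" "t < 1"
      and min: "\<And>u. 0 < u \<Longrightarrow> u < 1 \<Longrightarrow> target_root m q t \<le> target_root m q u"
      using target_root_argmin[OF assms q2] by auto
    have pos: "0 < target_root m q t" using target_root_pos[OF t(1)] q2 by simp
    have eq: "min_target m n q t = target_root m q t ^ n" using t by (simp add: min_target_eq)
    obtain u where u: "0 < u" "u < 1" and ub: "target_root m q u
        \<le> real m * exp (1 - \<alpha> / real m) / (real m ^ 2 - \<alpha> * real m + \<alpha>) * real q + exp 1"
      using target_root_upper[OF assms, of q] q2 by (auto simp: \<alpha>_def)
    show "\<exists>t. is_arg_min (min_target m n q) (\<lambda>t. t \<in> {0<..<1}) t \<and>
        (\<forall>F :: nat ring. field F \<longrightarrow> finite (carrier F) \<longrightarrow> card (carrier F) = q \<longrightarrow>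
           real (max_general m F n) < 2 * real m + real m * min_target m n q t) \<and>
        2 * real m + real m * min_target m n q t
          \<le> 2 * real m + real m *
              (real m * exp (1 - \<alpha> / real m) / (real m ^ 2 - \<alpha> * real m + \<alpha>) * real q + exp 1) ^ n"
    proof (intro exI[of _ t] conjI allI impI)
      show "is_arg_min (min_target m n q) (\<lambda>t. t \<in> {0<..<1}) t"
      proof -
        have "min_target m n q t \<le> min_target m n q v" if "0 < v" "v < 1" for v
          using min[OF that] pos that by (simp add: eq min_target_eq power_mono)
        then have "\<not> min_target m n q v < min_target m n q t" if "v \<in> {0<..<1}" for v
          using that by (simp add: not_less)
        then show ?thesis using t unfolding is_arg_min_def by simp
      qed
    next
      fix F :: "nat ring"
      assume F: "field F" "finite (carrier F)" "card (carrier F) = q"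
      have "0 < real m * target_root m q t ^ n" using pos assms by simp
      moreover have "real (card A) \<le> real m * target_root m q t ^ n" if "m_general m F n A" for A
        using m_general_card_le[OF F(1,2) assms n(2) _ that t] F(3) parity by simp
      ultimately show "real (max_general m F n) < 2 * real m + real m * min_target m n q t"
        unfolding eq using assms by (intro max_general_less[OF F(1,2)]) fastforce+
    next
      have "target_root m q t ^ n
          \<le> (real m * exp (1 - \<alpha> / real m) / (real m ^ 2 - \<alpha> * real m + \<alpha>) * real q + exp 1) ^ n"
        using min[OF u] ub pos by (intro power_mono) auto
      then show "2 * real m + real m * min_target m n q t
          \<le> 2 * real m + real m *
              (real m * exp (1 - \<alpha> / real m) / (real m ^ 2 - \<alpha> * real m + \<alpha>) * real q + exp 1) ^ n"
        unfolding eq by (intro add_left_mono mult_left_mono) auto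
    qed
  qed
qed

end
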